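(* Let $M$ be an $n$-manifold, $f:M\times[0,T)\to\mathbb R$ smooth, and $g(t)$, $t\in[0,T)$, a solution of the modified Ricci flow $\partial_tg_{ij}=-2R_{ij}+2\nabla_i\nabla_jf$. Let $\tau\in[0,T)$ and let $\tilde\nabla_\tau$ be the connection on $\tilde M_\tau=M\times[0,T-\tau)$ described in the context. Then, with left sides at $(x,t)$ and right sides at $(x,t+\tau)$, the curvature of $\tilde\nabla_\tau$ satisfies: (E1) $\tilde R_{ijk}^l=R_{ijk}^l$ for $1\le i,j,k,l\le n$; (E2) $\tilde R_{ijk}^0=0$ for $1\le i,j,k\le n$; (E3) $\tilde R_{ij0}^l=-\nabla_iR_j^l+\nabla_jR_i^l+R_{ijp}^l\nabla^pf$ for $1\le i,j,l\le n$; (E3') $\tilde R_{i0k}^l=-\nabla^lR_{ik}+\nabla_kR_i^l+R_{ipk}^l\nabla^pf$ for $1\le i,k,l\le n$; (E4) for $1\le i,l\le n$, $$\begin{aligned}\tilde R_{i00}^l&=\frac{\partial}{\partial t}R_i^l-\nabla^pf\nabla_pR_i^l-\tfrac12\nabla_i\nabla^lR-R_i^pR_p^l-\{\nabla_iR_p^l-\nabla_pR_i^l\}\nabla^pf-\{\nabla^lR_{ip}-\nabla_pR_i^l\}\nabla^pf\\&\quad+R_i^p\nabla_p\nabla^lf-R_p^l\nabla_i\nabla^pf+R_{ipq}^l\nabla^pf\nabla^qf\\&=\Delta R_i^l-\tfrac12\nabla_i\nabla^lR+2g^{lm}R_{pim}^qR_q^p-R_i^mR_m^l-g^{ql}P_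{ipq}\nabla^pf-g^{ql}P_{qpi}\nabla^pf+R_{ipq}^l\nabla^pf\nabla^qf.\end{aligned}$$
   Context: Conventions for a metric $g$ on $M$ with Christoffel symbols $\Gamma_{ij}^k$: $R_{ijk}^l=\partial_i\Gamma_{jk}^l-\partial_j\Gamma_{ik}^l+\Gamma_{jk}^m\Gamma_{im}^l-\Gamma_{ik}^m\Gamma_{jm}^l$, $R_{jk}=R_{pjk}^p$, $R=g^{jk}R_{jk}$, $R_i^l=g^{lm}R_{im}$; indices raised with $g^{-1}$, repeated indices summed over $1,\dots,n$; $P_{ijk}=\nabla_iR_{jk}-\nabla_jR_{ik}$. Coordinates $x^1,\dots,x^n$ on $M$, $x^0=t$. The connection $\tilde\nabla_\tau$ on $T\tilde M_\tau$ has Christoffel symbols (left at $(x,t)$, right from $g,f$ at $(x,t+\tau)$): $\tilde\Gamma_{ij}^k=\Gamma_{ij}^k$ ($1\le i,j,k\le n$); $\tilde\Gamma_{ij}^0=0$ ($0\le i,j\le n$); $\tilde\Gamma_{i0}^k=\tilde\Gamma_{0i}^k=-R_i^k+\nabla_i\nabla^kf$ ($1\le i,k\le n$); $\tilde\Gamma_{00}^k=\nabla^k\big(-\tfrac12R+\tfrac{\partial f}{\partial t}-\tfrac12|\nabla f|^2\big)$ ($1\le k\le n$). Its curvature is $\tilde R_{ijk}^l=\partial_i\tilde\Gamma_{jk}^l-\partial_j\tilde\Gamma_{ik}^l+\sum_{m=0}^n(\tilde\Gamma_{jk}^m\tilde\Gamma_{im}^l-\tilde\Gamma_{ik}^m\tilde\Gamma_{jm}^l)$,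 indices in $\{0,\dots,n\}$, $\partial_0=\partial_t$. *)

theory Defs
  imports "HOL-Analysis.Analysis"
begin

text \<open>Local-coordinate setting. Points of the space-time chart are pairs (x,t) with
  x :: real^'n (coordinates x^1..x^n, indexed by the finite type 'n, n = CARD('n)) and
  t :: real. Tensor components are real functions of such points.\<close>

fun Ck :: "nat \<Rightarrow> ('a::real_normed_vector) set \<Rightarrow> ('a \<Rightarrow> real) \<Rightarrow> bool" where
  "Ck 0 W F = continuous_on W F"
| "Ck (Suc k) W F = ((\<forall>z\<in>W. F differentiable (at z)) \<and>
      (\<forall>v. Ck k W (\<lambda>z. frechet_derivative F (at z) v)))"

definition Cinf_on :: "('a::real_normed_vector) set \<Rightarrow> ('a \<Rightarrow> real) \<Rightarrow> bool" where
  "Cinf_on W F = (\<forall>k. Ck k W F)"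

definition dpart :: "'n::finite \<Rightarrow> ((real^'n) \<times> real \<Rightarrow> real) \<Rightarrow> (real^'n) \<times> real \<Rightarrow> real" where
  "dpart i F z = deriv (\<lambda>s. F (z + s *\<^sub>R (axis i 1, 0))) 0"

definition dtime :: "((real^'n::finite) \<times> real \<Rightarrow> real) \<Rightarrow> (real^'n) \<times> real \<Rightarrow> real" where
  "dtime F z = deriv (\<lambda>s. F (z + s *\<^sub>R (0, 1))) 0"

type_synonym 'n metric = "'n \<Rightarrow> 'n \<Rightarrow> (real^'n) \<times> real \<Rightarrow> real"

definition ginv :: "('n::finite) metric \<Rightarrow> 'n metric" where
  "ginv g i j z = matrix_inv (\<chi> a b. g a b z) $ i $ j"

definition Chr :: "('n::finite) metric \<Rightarrow> 'n \<Rightarrow> 'n \<Rightarrow> 'n \<Rightarrow> (real^'n) \<times> real \<Rightarrow> real" where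
  "Chr g i j k z = (1/2) * (\<Sum>l\<in>UNIV. ginv g k l z *
       (dpart i (g j l) z + dpart j (g i l) z - dpart l (g i j) z))"

definition Riem :: "('n::finite) metric \<Rightarrow> 'n \<Rightarrow> 'n \<Rightarrow> 'n \<Rightarrow> 'n \<Rightarrow> (real^'n) \<times> real \<Rightarrow> real" where
  "Riem g i j k l z = dpart i (Chr g j k l) z - dpart j (Chr g i k l) z
     + (\<Sum>m\<in>UNIV. Chr g j k m z * Chr g i m l z - Chr g i k m z * Chr g j m l z)"

definition Ric :: "('n::finite) metric \<Rightarrow> 'n metric" where
  "Ric g j k z = (\<Sum>p\<in>UNIV. Riem g p j k p z)"

definition Scal :: "('n::finite) metric \<Rightarrow> (real^'n) \<times> real \<Rightarrow> real" where
  "Scal g z = (\<Sum>j\<in>UNIV. \<Sum>k\<in>UNIV. ginv g j k z * Ric g j k z)"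

definition RicM :: "('n::finite) metric \<Rightarrow> 'n metric" where
  "RicM g i l z = (\<Sum>m\<in>UNIV. ginv g l m z * Ric g i m z)"

definition Hess :: "('n::finite) metric \<Rightarrow> ((real^'n) \<times> real \<Rightarrow> real) \<Rightarrow> 'n metric" where
  "Hess g F i j z = dpart i (dpart j F) z - (\<Sum>k\<in>UNIV. Chr g i j k z * dpart k F z)"

definition gradU :: "('n::finite) metric \<Rightarrow> ((real^'n) \<times> real \<Rightarrow> real) \<Rightarrow> 'n \<Rightarrow> (real^'n) \<times> real \<Rightarrow> real" where
  "gradU g F k z = (\<Sum>l\<in>UNIV. ginv g k l z * dpart l F z)"

definition normsq :: "('n::finite) metric \<Rightarrow> ((real^'n) \<times> real \<Rightarrow> real) \<Rightarrow> (real^'n) \<times> real \<Rightarrow> real" where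
  "normsq g F z = (\<Sum>i\<in>UNIV. \<Sum>j\<in>UNIV. ginv g i j z * dpart i F z * dpart j F z)"

definition vecCov :: "('n::finite) metric \<Rightarrow> ('n \<Rightarrow> (real^'n) \<times> real \<Rightarrow> real) \<Rightarrow> 'n metric" where
  "vecCov g V i k z = dpart i (V k) z + (\<Sum>m\<in>UNIV. Chr g i m k z * V m z)"

definition HessU :: "('n::finite) metric \<Rightarrow> ((real^'n) \<times> real \<Rightarrow> real) \<Rightarrow> 'n metric" where
  "HessU g F = vecCov g (gradU g F)"

definition cov02 :: "('n::finite) metric \<Rightarrow> 'n metric \<Rightarrow> 'n \<Rightarrow> 'n \<Rightarrow> 'n \<Rightarrow> (real^'n) \<times> real \<Rightarrow> real" where
  "cov02 g T m i k z = dpart m (T i k) z - (\<Sum>q\<in>UNIV. Chr g m i q z * T q k z)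
      - (\<Sum>q\<in>UNIV. Chr g m k q z * T i q z)"

definition cov11 :: "('n::finite) metric \<Rightarrow> 'n metric \<Rightarrow> 'n \<Rightarrow> 'n \<Rightarrow> 'n \<Rightarrow> (real^'n) \<times> real \<Rightarrow> real" where
  "cov11 g T k i l z = dpart k (T i l) z - (\<Sum>q\<in>UNIV. Chr g k i q z * T q l z)
      + (\<Sum>q\<in>UNIV. Chr g k q l z * T i q z)"

definition cov12 :: "('n::finite) metric \<Rightarrow> ('n \<Rightarrow> 'n \<Rightarrow> 'n \<Rightarrow> (real^'n) \<times> real \<Rightarrow> real)
    \<Rightarrow> 'n \<Rightarrow> 'n \<Rightarrow> 'n \<Rightarrow> 'n \<Rightarrow> (real^'n) \<times> real \<Rightarrow> real" where
  "cov12 g S b a i l z = dpart b (S a i l) z - (\<Sum>q\<in>UNIV. Chr g b a q z * S q i l z)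
      - (\<Sum>q\<in>UNIV. Chr g b i q z * S a q l z) + (\<Sum>q\<in>UNIV. Chr g b q l z * S a i q z)"

definition Lap11 :: "('n::finite) metric \<Rightarrow> 'n metric \<Rightarrow> 'n metric" where
  "Lap11 g T i l z = (\<Sum>a\<in>UNIV. \<Sum>b\<in>UNIV. ginv g a b z * cov12 g (cov11 g T) a b i l z)"

definition Pt :: "('n::finite) metric \<Rightarrow> 'n \<Rightarrow> 'n \<Rightarrow> 'n \<Rightarrow> (real^'n) \<times> real \<Rightarrow> real" where
  "Pt g i j k z = cov02 g (Ric g) i j k z - cov02 g (Ric g) j i k z"

subsection \<open>The connection tilde-nabla_tau on M x [0,T-tau); index None plays the role of 0 (time)\<close>

definition tChr :: "('n::finite) metric \<Rightarrow> ((real^'n) \<times> real \<Rightarrow> real) \<Rightarrow> real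
    \<Rightarrow> 'n option \<Rightarrow> 'n option \<Rightarrow> 'n option \<Rightarrow> (real^'n) \<times> real \<Rightarrow> real" where
  "tChr g f \<tau> a b c z = (let w = (fst z, snd z + \<tau>) in
     (case (a, b, c) of
        (_, _, None) \<Rightarrow> 0
      | (Some i, Some j, Some k) \<Rightarrow> Chr g i j k w
      | (Some i, None, Some k) \<Rightarrow> - RicM g i k w + HessU g f i k w
      | (None, Some i, Some k) \<Rightarrow> - RicM g i k w + HessU g f i k w
      | (None, None, Some k) \<Rightarrow>
           gradU g (\<lambda>y. - Scal g y / 2 + dtime f y - normsq g f y / 2) k w))"

definition tdpart :: "('n::finite) option \<Rightarrow> ((real^'n) \<times> real \<Rightarrow> real) \<Rightarrow> (real^'n) \<times> real \<Rightarrow> real" where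
  "tdpart a F z = (case a of None \<Rightarrow> dtime F z | Some i \<Rightarrow> dpart i F z)"

definition tRiem :: "('n::finite) metric \<Rightarrow> ((real^'n) \<times> real \<Rightarrow> real) \<Rightarrow> real
    \<Rightarrow> 'n option \<Rightarrow> 'n option \<Rightarrow> 'n option \<Rightarrow> 'n option \<Rightarrow> (real^'n) \<times> real \<Rightarrow> real" where
  "tRiem g f \<tau> a b c d z = tdpart a (tChr g f \<tau> b c d) z - tdpart b (tChr g f \<tau> a c d) z
     + (\<Sum>m\<in>UNIV. tChr g f \<tau> b c m z * tChr g f \<tau> a m d z
                 - tChr g f \<tau> a c m z * tChr g f \<tau> b m d z)"

end

theory Submission
  imports Defs
begin

text \<open>
  Every quantity in the theorem is a polynomial in partial derivatives of \<open>g\<close>, \<open>g\<inverse>\<close> and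
  \<open>f\<close> at one point, so all identities are checked in the ring of formal jets at that point (all
  partial derivatives, multiplied by the Leibniz rule), where the differential operators are
  commuting derivations and the flow equation is an equation between ring elements.

  Put \<open>S = - Ric + \<nabla>\<nabla>f\<close>, so that \<open>\<partial>\<^sub>t g = 2 S\<close>. The spatial part of the space-time connection,
  \<open>D = \<partial>\<^sub>t + S\<close> in the time direction and \<open>\<nabla>\<^sub>i\<close> in the space directions, acts on spatial vector
  fields and preserves the metric \<open>g\<close>. Its curvature \<open>F\<close> is therefore skew, and Koszul's argument
  gives \<open>F\<^sub>i\<^sub>0\<close> from \<open>F\<^sub>i\<^sub>0 e\<^sub>k - F\<^sub>k\<^sub>0 e\<^sub>i = \<nabla>\<^sub>i S\<^sub>k - \<nabla>\<^sub>k S\<^sub>i\<close> without differentiating the Christoffel symbols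
  in time. With \<open>W\<close> the gradient of \<open>- R/2 + \<partial>\<^sub>t f - |\<nabla>f|\<^sup>2/2\<close> one finds
  \<open>W - D \<nabla>f = - \<nabla>R/2 - Ric(\<nabla>f)\<close>, and (E4) is \<open>\<nabla>\<^sub>i W - D S\<^sub>i = \<nabla>\<^sub>i (W - D \<nabla>f) + D Ric\<^sub>i + F\<^sub>i\<^sub>0 \<nabla>f\<close>.
  The second form of (E4) needs the evolution of the Ricci tensor, which is the trace of the Jacobi
  identity for \<open>D, \<nabla>\<^sub>i, \<nabla>\<^sub>j\<close>.
\<close>

section \<open>Formal jets\<close>

text \<open>A jet assigns to each list of directions an iterated partial derivative, head of the
  list first. Fixing the head is therefore differentiation in that direction.\<close>

definition shift :: "'k \<Rightarrow> ('k list \<Rightarrow> real) \<Rightarrow> 'k list \<Rightarrow> real" where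
  "shift a F = (\<lambda>xs. F (a # xs))"

text \<open>The product of two jets. The recursion is the product rule, so \<open>shift\<close> is a
  derivation for it by definition.\<close>

fun leibniz :: "('k list \<Rightarrow> real) \<Rightarrow> ('k list \<Rightarrow> real) \<Rightarrow> 'k list \<Rightarrow> real" where
  "leibniz F G [] = F [] * G []"
| "leibniz F G (a # xs) = leibniz (shift a F) G xs + leibniz F (shift a G) xs"

lemma shift_simps [simp]:
  "shift a (\<lambda>xs. F xs + G xs) = (\<lambda>xs. shift a F xs + shift a G xs)"
  "shift a (\<lambda>xs. 0) = (\<lambda>xs. 0)"
  "shift a (leibniz F G) = (\<lambda>xs. leibniz (shift a F) G xs + leibniz F (shift a G) xs)"
  "shift a (\<lambda>xs. if xs = [] then c else 0) = (\<lambda>xs. 0)"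
  by (auto simp: shift_def fun_eq_iff)

lemma leibniz_add_left:
  "leibniz (\<lambda>xs. F xs + F' xs) G xs = leibniz F G xs + leibniz F' G xs"
  by (induction xs arbitrary: F F' G) (auto simp: algebra_simps)

lemma leibniz_add_right:
  "leibniz F (\<lambda>xs. G xs + G' xs) xs = leibniz F G xs + leibniz F G' xs"
  by (induction xs arbitrary: F G G') (auto simp: algebra_simps)

lemma leibniz_commute: "leibniz F G xs = leibniz G F xs"
  by (induction xs arbitrary: F G) (auto simp: algebra_simps)

lemma leibniz_assoc: "leibniz (leibniz F G) H xs = leibniz F (leibniz G H) xs"
  by (induction xs arbitrary: F G H) (auto simp: leibniz_add_left leibniz_add_right algebra_simps)

lemma leibniz_zero: "leibniz (\<lambda>xs. 0) F xs = 0"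
  by (induction xs arbitrary: F) auto

lemma leibniz_one: "leibniz (\<lambda>xs. if xs = [] then 1 else 0) F xs = F xs"
  by (induction xs arbitrary: F) (auto simp: leibniz_zero, auto simp: shift_def)

text \<open>Schwarz's theorem for coefficients; adjacent swaps generate all permutations.\<close>

definition sym_jet :: "('k list \<Rightarrow> real) \<Rightarrow> bool" where
  "sym_jet F \<longleftrightarrow> (\<forall>xs a b ys. F (xs @ a # b # ys) = F (xs @ b # a # ys))"

lemma sym_jet_shift: "sym_jet F \<Longrightarrow> sym_jet (shift a F)"
  unfolding sym_jet_def shift_def by (metis append_Cons)

lemma sym_jet_shift_commute: "sym_jet F \<Longrightarrow> shift a (shift b F) = shift b (shift a F)"
  unfolding sym_jet_def shift_def by (metis append_Nil)

text \<open>A common prefix is absorbed into shifted factors, which stay symmetric. At the front,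
  two derivatives of a product give four terms, and exchanging the directions permutes the mixed
  ones.\<close>

lemma sym_jet_leibniz:
  assumes "sym_jet F" "sym_jet G"
  shows "sym_jet (leibniz F G)"
proof -
  have "leibniz F G (xs @ a # b # ys) = leibniz F G (xs @ b # a # ys)" for xs a b ys
    using assms
  proof (induction xs arbitrary: F G)
    case Nil
    then show ?case by (simp add: sym_jet_shift_commute[of F a b] sym_jet_shift_commute[of G a b])
  next
    case (Cons c xs)
    then show ?case by (simp add: sym_jet_shift)
  qed
  then show ?thesis by (simp add: sym_jet_def)
qed

text \<open>Up to factorials these are formal power series in variables indexed by
  \<open>'k\<close>. Symmetry is built into the type so that the derivations
  \<open>jet_deriv\<close> commute.\<close>

typedef 'k jet = "{F :: 'k list \<Rightarrow> real. sym_jet F}"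
  morphisms coeff_jet Jet
  by (rule exI[of _ "\<lambda>_. 0"]) (simp add: sym_jet_def)

setup_lifting type_definition_jet

instantiation jet :: (type) comm_ring_1
begin
lift_definition zero_jet :: "'a jet" is "\<lambda>xs. 0" by (simp add: sym_jet_def)
lift_definition one_jet :: "'a jet" is "\<lambda>xs. if xs = [] then 1 else 0" by (simp add: sym_jet_def)
lift_definition plus_jet :: "'a jet \<Rightarrow> 'a jet \<Rightarrow> 'a jet" is "\<lambda>F G xs. F xs + G xs"
  by (auto simp: sym_jet_def)
lift_definition minus_jet :: "'a jet \<Rightarrow> 'a jet \<Rightarrow> 'a jet" is "\<lambda>F G xs. F xs - G xs"
  by (auto simp: sym_jet_def)
lift_definition uminus_jet :: "'a jet \<Rightarrow> 'a jet" is "\<lambda>F xs. - F xs"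
  by (auto simp: sym_jet_def)
lift_definition times_jet :: "'a jet \<Rightarrow> 'a jet \<Rightarrow> 'a jet" is leibniz
  by (rule sym_jet_leibniz)
instance
proof
  show "(0::'a jet) \<noteq> 1" by transfer (auto simp: fun_eq_iff)
qed (transfer; auto simp: fun_eq_iff leibniz_assoc leibniz_add_left leibniz_one intro: leibniz_commute)+
end

lift_definition jet_deriv :: "'k \<Rightarrow> 'k jet \<Rightarrow> 'k jet" is shift
  by (rule sym_jet_shift)

lemma jet_deriv_add: "jet_deriv a (F + G) = jet_deriv a F + jet_deriv a G"
  by transfer simp

lemma jet_deriv_mult: "jet_deriv a (F * G) = jet_deriv a F * G + F * jet_deriv a G"
  by transfer simp

lemma jet_deriv_commute: "jet_deriv a (jet_deriv b F) = jet_deriv b (jet_deriv a F)"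
  by transfer (rule sym_jet_shift_commute)

section \<open>Smooth functions and their jets\<close>

text \<open>On an open set the derivative depends only on values inside the set, so agreement on
  \<open>W\<close> passes to all derivatives.\<close>

lemma Ck_cong:
  assumes "open W" "\<And>z. z \<in> W \<Longrightarrow> F z = G z" "Ck k W F"
  shows "Ck k W G"
  using assms(2,3)
proof (induction k arbitrary: F G)
  case 0
  then show ?case using continuous_on_cong[of W W F G] by simp
next
  case (Suc k)
  have der: "(G has_derivative frechet_derivative F (at z)) (at z)" if "z \<in> W" for z
  proof -
    have "(F has_derivative frechet_derivative F (at z)) (at z)"
      using Suc.prems(2) that frechet_derivative_works by auto
    then show ?thesis
      using has_derivative_transform_within_open[of F _ z UNIV W G] assms(1) that Suc.prems(1) by auto
  qed
  then have fd: "frechet_derivative G (at z) = frechet_derivative F (at z)" if "z \<in> W" for z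
    using frechet_derivative_at that by metis
  have "Ck k W (\<lambda>z. frechet_derivative G (at z) v)" for v
    by (rule Suc.IH[of "\<lambda>z. frechet_derivative F (at z) v"]) (use fd Suc.prems in auto)
  then show ?case
    using der by (auto intro: differentiableI)
qed

lemma Ck_has_derivative:
  "Ck (Suc k) W F \<Longrightarrow> z \<in> W \<Longrightarrow> (F has_derivative frechet_derivative F (at z)) (at z)"
  using frechet_derivative_works by auto

text \<open>Allows an explicit derivative formula in place of \<open>frechet_derivative\<close>, so
  closure under an operation reduces to its differentiation rule.\<close>

lemma Ck_SucI:
  assumes "open W" "\<And>z. z \<in> W \<Longrightarrow> (F has_derivative F' z) (at z)" "\<And>v. Ck k W (\<lambda>z. F' z v)"
  shows "Ck (Suc k) W F"
proof -
  have "F' z v = frechet_derivative F (at z) v" if "z \<in> W" for z v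
    using frechet_derivative_at[OF assms(2)[OF that]] by simp
  then have "Ck k W (\<lambda>z. frechet_derivative F (at z) v)" for v
    by (intro Ck_cong[OF assms(1) _ assms(3)]) auto
  then show ?thesis
    using assms(2) by (auto intro: differentiableI)
qed

lemma Ck_continuous: "Ck k W F \<Longrightarrow> open W \<Longrightarrow> continuous_on W F"
  by (cases k)
    (auto simp: continuous_on_eq_continuous_at intro!: differentiable_imp_continuous_within)

lemma Ck_antimono: "Ck (Suc k) W F \<Longrightarrow> open W \<Longrightarrow> Ck k W F"
proof (induction k arbitrary: F)
  case 0
  then show ?case using Ck_continuous[of "Suc 0" W F] by simp
next
  case (Suc k)
  from Suc.prems(1) have "Ck (Suc k) W (\<lambda>z. frechet_derivative F (at z) v)" for v
    by (subst (asm) Ck.simps(2)) blast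
  then have "Ck k W (\<lambda>z. frechet_derivative F (at z) v)" for v
    using Suc by blast
  then show ?case using Suc.prems by auto
qed

lemma Ck_const: "Ck k W (\<lambda>z. c)"
  by (induction k arbitrary: c) auto

lemma Ck_add:
  assumes "open W" "Ck k W F" "Ck k W G"
  shows "Ck k W (\<lambda>z. F z + G z)"
  using assms(2,3)
proof (induction k arbitrary: F G)
  case 0
  then show ?case by (simp add: continuous_on_add)
next
  case (Suc k)
  then show ?case
    by (intro Ck_SucI[OF assms(1), where F' = "\<lambda>z v. frechet_derivative F (at z) v + frechet_derivative G (at z) v"])
      (auto intro!: has_derivative_add Ck_has_derivative[of k W])
qed

lemma Ck_mult:
  assumes "open W" "Ck k W F" "Ck k W G"
  shows "Ck k W (\<lambda>z. F z * G z)"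
  using assms(2,3)
proof (induction k arbitrary: F G)
  case 0
  then show ?case by (simp add: continuous_on_mult)
next
  case (Suc k)
  have "Ck k W F" "Ck k W G"
    using Ck_antimono assms(1) Suc.prems by blast+
  with Suc show ?case
    by (intro Ck_SucI[OF assms(1), where F' = "\<lambda>z v. F z * frechet_derivative G (at z) v + frechet_derivative F (at z) v * G z"])
      (auto intro!: has_derivative_mult Ck_has_derivative[of k W] Ck_add[OF assms(1)])
qed

text \<open>The derivative of \<open>1/F\<close> involves only \<open>F'\<close> and
  \<open>1/F\<close> itself, and the induction hypothesis covers \<open>1/F\<close> at one order
  less.\<close>

lemma Ck_inverse:
  assumes "open W" "Ck k W F" "\<And>z. z \<in> W \<Longrightarrow> F z \<noteq> 0"
  shows "Ck k W (\<lambda>z. inverse (F z))"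
  using assms(2)
proof (induction k)
  case 0
  then show ?case by (simp add: continuous_on_inverse assms(3))
next
  case (Suc k)
  have "Ck k W (\<lambda>z. inverse (F z))"
    using Ck_antimono[OF Suc.prems assms(1)] Suc.IH by blast
  moreover have "Ck k W (\<lambda>z. - 1 * (inverse (F z) * frechet_derivative F (at z) v * inverse (F z)))" for v
    by (intro Ck_mult[OF assms(1)] Ck_const calculation) (use Suc.prems in auto)
  ultimately show ?case
    by (intro Ck_SucI[OF assms(1), where F' = "\<lambda>z v. - (inverse (F z) * frechet_derivative F (at z) v * inverse (F z))"]
        Deriv.has_derivative_inverse[OF assms(3) Ck_has_derivative[OF Suc.prems]]) auto
qed

lemma Ck_subset: "Ck k W F \<Longrightarrow> W' \<subseteq> W \<Longrightarrow> Ck k W' F"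
  by (induction k arbitrary: F) (auto intro: continuous_on_subset)

section \<open>Equality of mixed partial derivatives\<close>

lemma has_derivative_along_line:
  fixes F :: "'a::real_normed_vector \<Rightarrow> real"
  assumes "(F has_derivative F') (at (z + s *\<^sub>R v))"
  shows "((\<lambda>s. F (z + s *\<^sub>R v)) has_field_derivative F' v) (at s)"
proof -
  have "((\<lambda>s. z + s *\<^sub>R v) has_derivative (\<lambda>h. h *\<^sub>R v)) (at s)"
    by (auto intro!: derivative_eq_intros)
  from diff_chain_at[OF this, of F F'] assms
  have "((\<lambda>s. F (z + s *\<^sub>R v)) has_derivative (\<lambda>h. F' (h *\<^sub>R v))) (at s)"
    by (simp add: o_def)
  moreover have "F' (h *\<^sub>R v) = F' v * h" for h
    using linear_cmul[OF has_derivative_linear[OF assms]] by simp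
  ultimately show ?thesis
    by (simp add: has_field_derivative_def)
qed

text \<open>The mean value theorem is applied to \<open>s \<mapsto> F (z + h w + s v) - F (z + s v)\<close>, and then to the
  derivative of \<open>F\<close> along \<open>v\<close> on a segment in direction \<open>w\<close>.\<close>

lemma second_difference:
  fixes F :: "'a::real_normed_vector \<Rightarrow> real"
  assumes C2: "Ck 2 W F" and h: "h > 0"
    and sub: "\<And>a b. 0 \<le> a \<Longrightarrow> a \<le> h \<Longrightarrow> 0 \<le> b \<Longrightarrow> b \<le> h \<Longrightarrow> z + a *\<^sub>R v + b *\<^sub>R w \<in> W"
  obtains a b where "0 \<le> a" "a \<le> h" "0 \<le> b" "b \<le> h"
    "F (z + h *\<^sub>R v + h *\<^sub>R w) - F (z + h *\<^sub>R v) - F (z + h *\<^sub>R w) + F z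
      = h * h * frechet_derivative (\<lambda>y. frechet_derivative F (at y) v) (at (z + a *\<^sub>R v + b *\<^sub>R w)) w"
proof -
  define F1 where "F1 = (\<lambda>y. frechet_derivative F (at y) v)"
  have d1: "y \<in> W \<Longrightarrow> (F has_derivative frechet_derivative F (at y)) (at y)" for y
    using C2 Ck_has_derivative[of 1 W F] by (simp add: numeral_2_eq_2)
  have d2: "y \<in> W \<Longrightarrow> (F1 has_derivative frechet_derivative F1 (at y)) (at y)" for y
    using C2 Ck_has_derivative[of 0 W F1] by (simp add: numeral_2_eq_2 F1_def)
  let ?u = "\<lambda>s. F ((z + h *\<^sub>R w) + s *\<^sub>R v) - F (z + s *\<^sub>R v)"
  have "(?u has_field_derivative F1 ((z + h *\<^sub>R w) + s *\<^sub>R v) - F1 (z + s *\<^sub>R v)) (at s)"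
    if "0 \<le> s" "s \<le> h" for s
    unfolding F1_def
    using d1[OF sub[of s h]] d1[OF sub[of s 0]] that h
    by (intro DERIV_diff has_derivative_along_line) (auto simp: add.commute add.left_commute)
  from MVT2[OF h this] obtain a where a: "0 < a" "a < h"
    "?u h - ?u 0 = h * (F1 ((z + h *\<^sub>R w) + a *\<^sub>R v) - F1 (z + a *\<^sub>R v))"
    by auto
  have "((\<lambda>s. F1 ((z + a *\<^sub>R v) + s *\<^sub>R w)) has_field_derivative
      frechet_derivative F1 (at ((z + a *\<^sub>R v) + s *\<^sub>R w)) w) (at s)" if "0 \<le> s" "s \<le> h" for s
    using d2[OF sub[of a s]] that a by (intro has_derivative_along_line) auto
  from MVT2[OF h this] obtain b where b: "0 < b" "b < h"
    "F1 ((z + a *\<^sub>R v) + h *\<^sub>R w) - F1 (z + a *\<^sub>R v)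
      = h * frechet_derivative F1 (at ((z + a *\<^sub>R v) + b *\<^sub>R w)) w"
    by auto
  show thesis
  proof (rule that[of a b])
    have "F (z + h *\<^sub>R v + h *\<^sub>R w) - F (z + h *\<^sub>R v) - F (z + h *\<^sub>R w) + F z = ?u h - ?u 0"
      by (simp add: add.commute add.left_commute)
    also have "\<dots> = h * (F1 ((z + a *\<^sub>R v) + h *\<^sub>R w) - F1 (z + a *\<^sub>R v))"
      by (simp only: a(3)) (simp add: add.commute add.left_commute)
    finally show "F (z + h *\<^sub>R v + h *\<^sub>R w) - F (z + h *\<^sub>R v) - F (z + h *\<^sub>R w) + F z
      = h * h * frechet_derivative (\<lambda>y. frechet_derivative F (at y) v) (at (z + a *\<^sub>R v + b *\<^sub>R w)) w"
      using b(3) by (simp add: F1_def)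
  qed (use a b in auto)
qed

text \<open>The second difference over a parallelogram is symmetric in \<open>v\<close> and
  \<open>w\<close> and equals \<open>h * h\<close> times either mixed derivative at some point of
  the parallelogram. Continuity at \<open>z\<close> lets the parallelogram shrink.\<close>

lemma mixed_derivatives_commute:
  fixes F :: "'a::real_normed_vector \<Rightarrow> real"
  assumes W: "open W" and C2: "Ck 2 W F" and z: "z \<in> W"
  shows "frechet_derivative (\<lambda>y. frechet_derivative F (at y) v) (at z) w
       = frechet_derivative (\<lambda>y. frechet_derivative F (at y) w) (at z) v"
proof -
  define P where "P v w y = frechet_derivative (\<lambda>y. frechet_derivative F (at y) v) (at y) w" for v w y
  have cont: "isCont (P v w) z" for v w
    using C2 W z unfolding P_def by (simp add: numeral_2_eq_2 continuous_on_eq_continuous_at)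
  have "\<bar>P v w z - P w v z\<bar> \<le> e" if e: "e > 0" for e
  proof -
    obtain d1 where d1: "d1 > 0" "\<And>y. dist y z < d1 \<Longrightarrow> \<bar>P v w y - P v w z\<bar> < e / 2"
      using cont[of v w] e unfolding continuous_at_eps_delta dist_real_def by (meson half_gt_zero)
    obtain d2 where d2: "d2 > 0" "\<And>y. dist y z < d2 \<Longrightarrow> \<bar>P w v y - P w v z\<bar> < e / 2"
      using cont[of w v] e unfolding continuous_at_eps_delta dist_real_def by (meson half_gt_zero)
    obtain d3 where d3: "d3 > 0" "\<And>y. dist y z < d3 \<Longrightarrow> y \<in> W"
      using W z unfolding open_dist by blast
    define d where "d = min d1 (min d2 d3)"
    \<comment> \<open>All points of the parallelogram with sides \<open>h v\<close> and
      \<open>h w\<close> then lie within \<open>d\<close> of \<open>z\<close>; the summand 1 keeps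
      the denominator positive when both vectors vanish.\<close>
    define h where "h = d / (norm v + norm w + 1)"
    have pos: "norm v + norm w + 1 > 0" by (smt (verit) norm_ge_zero)
    have h: "h > 0" using d1 d2 d3 pos by (simp add: h_def d_def)
    have near: "dist (z + a *\<^sub>R v + b *\<^sub>R w) z < d" if "0 \<le> a" "a \<le> h" "0 \<le> b" "b \<le> h" for a b
    proof -
      have "dist (z + a *\<^sub>R v + b *\<^sub>R w) z = norm (a *\<^sub>R v + b *\<^sub>R w)"
        by (simp add: dist_norm add.assoc)
      also have "\<dots> \<le> h * norm v + h * norm w"
        using that by (intro norm_triangle_le add_mono) (auto simp: mult_right_mono)
      also have "\<dots> < h * (norm v + norm w + 1)" using h by (simp add: algebra_simps)
      also have "\<dots> = d" using pos by (simp add: h_def)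
      finally show ?thesis .
    qed
    obtain a b where ab: "0 \<le> a" "a \<le> h" "0 \<le> b" "b \<le> h"
      "F (z + h *\<^sub>R v + h *\<^sub>R w) - F (z + h *\<^sub>R v) - F (z + h *\<^sub>R w) + F z
        = h * h * P v w (z + a *\<^sub>R v + b *\<^sub>R w)"
      unfolding P_def
      by (rule second_difference[OF C2 h, of z v w]) (use near d3 d_def in force)+
    obtain a' b' where ab': "0 \<le> a'" "a' \<le> h" "0 \<le> b'" "b' \<le> h"
      "F (z + h *\<^sub>R w + h *\<^sub>R v) - F (z + h *\<^sub>R w) - F (z + h *\<^sub>R v) + F z
        = h * h * P w v (z + a' *\<^sub>R w + b' *\<^sub>R v)"
      unfolding P_def
      by (rule second_difference[OF C2 h, of z w v])
        (use near d3 d_def in \<open>force simp: add.commute add.left_commute\<close>)+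
    have "h * h * P v w (z + a *\<^sub>R v + b *\<^sub>R w) = h * h * P w v (z + a' *\<^sub>R w + b' *\<^sub>R v)"
      using ab(5) ab'(5) by (simp add: algebra_simps)
    then have eq: "P v w (z + a *\<^sub>R v + b *\<^sub>R w) = P w v (z + a' *\<^sub>R w + b' *\<^sub>R v)"
      using h by simp
    have "\<bar>P v w (z + a *\<^sub>R v + b *\<^sub>R w) - P v w z\<bar> < e / 2"
      using near[OF ab(1-4)] d1 by (simp add: d_def)
    moreover have "\<bar>P w v (z + a' *\<^sub>R w + b' *\<^sub>R v) - P w v z\<bar> < e / 2"
      using near[OF ab'(3,4,1,2)] d2 by (simp add: d_def add.commute add.left_commute)
    ultimately show ?thesis using eq by linarith
  qed
  then have "P v w z = P w v z"
    by (metis abs_le_zero_iff eq_iff_diff_eq_0 field_le_epsilon add_0)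
  then show ?thesis by (simp add: P_def)
qed

section \<open>Closure properties of smooth functions\<close>

lemma Cinf_on_cong:
  "open W \<Longrightarrow> (\<And>z. z \<in> W \<Longrightarrow> F z = G z) \<Longrightarrow> Cinf_on W F \<Longrightarrow> Cinf_on W G"
  unfolding Cinf_on_def using Ck_cong by blast

lemma Cinf_on_subset: "Cinf_on W F \<Longrightarrow> W' \<subseteq> W \<Longrightarrow> Cinf_on W' F"
  unfolding Cinf_on_def using Ck_subset by blast

lemma Cinf_on_const: "Cinf_on W (\<lambda>z. c)"
  by (simp add: Cinf_on_def Ck_const)

lemma Cinf_on_add:
  "open W \<Longrightarrow> Cinf_on W F \<Longrightarrow> Cinf_on W G \<Longrightarrow> Cinf_on W (\<lambda>z. F z + G z)"
  by (simp add: Cinf_on_def Ck_add)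

lemma Cinf_on_mult:
  "open W \<Longrightarrow> Cinf_on W F \<Longrightarrow> Cinf_on W G \<Longrightarrow> Cinf_on W (\<lambda>z. F z * G z)"
  by (simp add: Cinf_on_def Ck_mult)

lemma Cinf_on_uminus: "open W \<Longrightarrow> Cinf_on W F \<Longrightarrow> Cinf_on W (\<lambda>z. - F z)"
  using Cinf_on_mult[OF _ Cinf_on_const, of W F "- 1"] by simp

lemma Cinf_on_diff:
  "open W \<Longrightarrow> Cinf_on W F \<Longrightarrow> Cinf_on W G \<Longrightarrow> Cinf_on W (\<lambda>z. F z - G z)"
  using Cinf_on_add[OF _ _ Cinf_on_uminus, of W F G] by simp

lemma Cinf_on_divide:
  assumes "open W" "Cinf_on W F" "Cinf_on W G" "\<And>z. z \<in> W \<Longrightarrow> G z \<noteq> 0"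
  shows "Cinf_on W (\<lambda>z. F z / G z)"
  using assms by (simp add: divide_inverse Cinf_on_def Ck_mult Ck_inverse)

lemma Cinf_on_sum:
  "open W \<Longrightarrow> (\<And>i. i \<in> I \<Longrightarrow> Cinf_on W (F i)) \<Longrightarrow> Cinf_on W (\<lambda>z. \<Sum>i\<in>I. F i z)"
  by (induction I rule: infinite_finite_induct) (auto intro: Cinf_on_const Cinf_on_add)

lemma Cinf_on_prod:
  "open W \<Longrightarrow> (\<And>i. i \<in> I \<Longrightarrow> Cinf_on W (F i)) \<Longrightarrow> Cinf_on W (\<lambda>z. \<Prod>i\<in>I. F i z)"
  by (induction I rule: infinite_finite_induct) (auto intro: Cinf_on_const Cinf_on_mult)

lemma Cinf_on_frechet_derivative:
  "Cinf_on W F \<Longrightarrow> Cinf_on W (\<lambda>z. frechet_derivative F (at z) v)"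
  unfolding Cinf_on_def by (metis Ck.simps(2))

lemma Cinf_on_has_derivative:
  "Cinf_on W F \<Longrightarrow> z \<in> W \<Longrightarrow> (F has_derivative frechet_derivative F (at z)) (at z)"
  using Ck_has_derivative unfolding Cinf_on_def by blast

lemma Cinf_on_det:
  fixes A :: "'n::finite \<Rightarrow> 'n \<Rightarrow> 'a::real_normed_vector \<Rightarrow> real"
  assumes "open W" "\<And>i j. Cinf_on W (A i j)"
  shows "Cinf_on W (\<lambda>z. det (\<chi> i j. A i j z))"
  unfolding det_def using assms
  by (auto intro!: Cinf_on_sum Cinf_on_mult Cinf_on_prod Cinf_on_const)

lemma matrix_inv_inverse:
  fixes A :: "'a::field^'n^'n"
  assumes "det A \<noteq> 0"
  shows "A ** matrix_inv A = mat 1" and "matrix_inv A ** A = mat 1"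
  using assms someI_ex[of "\<lambda>B. A ** B = mat 1 \<and> B ** A = mat 1"]
  unfolding invertible_det_nz[symmetric] invertible_def matrix_inv_def by blast+

text \<open>Cramer's rule writes each entry of the inverse matrix as a quotient of
  determinants.\<close>

lemma Cinf_on_ginv:
  assumes W: "open W" and g: "\<And>i j. Cinf_on W (g i j)"
    and det: "\<And>z. z \<in> W \<Longrightarrow> det (\<chi> a b. g a b z) \<noteq> 0"
  shows "Cinf_on W (ginv g k l)"
proof (rule Cinf_on_cong[OF W])
  let ?num = "\<lambda>z. det (\<chi> i j. if j = k then axis l 1 $ i else g i j z)"
  show "?num z / det (\<chi> a b. g a b z) = ginv g k l z" if "z \<in> W" for z
  proof -
    let ?A = "\<chi> a b. g a b z"
    have "?A *v column l (matrix_inv ?A) = column l (mat 1)"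
      using matrix_inv_inverse(1)[OF det[OF that]]
      by (simp add: vec_eq_iff matrix_matrix_mult_def matrix_vector_mult_def column_def)
    also have "\<dots> = axis l 1"
      by (simp add: vec_eq_iff column_def mat_def axis_def)
    finally have "column l (matrix_inv ?A) = (\<chi> k. det (\<chi> i j. if j = k then axis l 1 $ i else ?A $ i $ j) / det ?A)"
      using cramer[OF det[OF that]] by blast
    then show ?thesis
      by (simp add: vec_eq_iff column_def ginv_def cong: if_cong)
  qed
  have "Cinf_on W (\<lambda>z. if j = k then axis l 1 $ i else g i j z)" for i j
    using g by (cases "j = k") (auto intro: Cinf_on_const)
  then show "Cinf_on W (\<lambda>z. ?num z / det (\<chi> a b. g a b z))"
    by (intro Cinf_on_divide Cinf_on_det W g det)
qed

section \<open>Space and time derivatives as directional derivatives\<close>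

definition tdir :: "'n option \<Rightarrow> (real^'n) \<times> real" where
  "tdir a = (case a of None \<Rightarrow> (0, 1) | Some i \<Rightarrow> (axis i 1, 0))"

lemma tdpart_eq_deriv: "tdpart a F z = deriv (\<lambda>s. F (z + s *\<^sub>R tdir a)) 0"
  by (auto simp: tdpart_def tdir_def dpart_def dtime_def split: option.split)

lemma DERIV_tdpart:
  assumes "F differentiable (at z)"
  shows "((\<lambda>s. F (z + s *\<^sub>R tdir a)) has_field_derivative tdpart a F z) (at 0)"
    and "tdpart a F z = frechet_derivative F (at z) (tdir a)"
proof -
  have "((\<lambda>s. F (z + s *\<^sub>R tdir a)) has_field_derivative frechet_derivative F (at z) (tdir a)) (at 0)"
    using assms by (intro has_derivative_along_line) (simp add: frechet_derivative_works)
  then show "tdpart a F z = frechet_derivative F (at z) (tdir a)"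
    unfolding tdpart_eq_deriv by (rule DERIV_imp_deriv)
  with \<open>(_ has_field_derivative _) _\<close>
  show "((\<lambda>s. F (z + s *\<^sub>R tdir a)) has_field_derivative tdpart a F z) (at 0)"
    by simp
qed

lemma Cinf_on_differentiable: "Cinf_on W F \<Longrightarrow> z \<in> W \<Longrightarrow> F differentiable (at z)"
  by (meson Cinf_on_has_derivative differentiableI)

lemma Cinf_on_tdpart: "open W \<Longrightarrow> Cinf_on W F \<Longrightarrow> Cinf_on W (tdpart a F)"
  by (rule Cinf_on_cong[OF _ _ Cinf_on_frechet_derivative[of W F "tdir a"]])
    (auto simp: DERIV_tdpart(2) Cinf_on_differentiable)

text \<open>A case of \<open>mixed_derivatives_commute\<close>, once \<open>tdpart b F\<close> is
  replaced by a Frechet derivative on all of \<open>W\<close> before the second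
  differentiation.\<close>

lemma tdpart_commute:
  assumes "open W" "Cinf_on W F" "z \<in> W"
  shows "tdpart a (tdpart b F) z = tdpart b (tdpart a F) z"
proof -
  have "tdpart a (tdpart b F) z = frechet_derivative (\<lambda>y. frechet_derivative F (at y) (tdir b)) (at z) (tdir a)"
    for a b
  proof -
    have der: "((\<lambda>y. frechet_derivative F (at y) (tdir b)) has_derivative
       frechet_derivative (\<lambda>y. frechet_derivative F (at y) (tdir b)) (at z)) (at z)"
      using assms Cinf_on_has_derivative Cinf_on_frechet_derivative by blast
    have "(tdpart b F has_derivative
       frechet_derivative (\<lambda>y. frechet_derivative F (at y) (tdir b)) (at z)) (at z)"
      using has_derivative_transform_within_open[OF der, of W] assms
      by (simp add: DERIV_tdpart(2) Cinf_on_differentiable)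
    then show ?thesis
      using frechet_derivative_at assms DERIV_tdpart(2) differentiableI by metis
  qed
  then show ?thesis
    using mixed_derivatives_commute[OF assms(1) _ assms(3), of F] assms(2) by (simp add: Cinf_on_def)
qed

lemma tdpart_add:
  assumes "F differentiable (at z)" "G differentiable (at z)"
  shows "tdpart a (\<lambda>y. F y + G y) z = tdpart a F z + tdpart a G z"
  unfolding tdpart_eq_deriv[of a "\<lambda>y. F y + G y"]
  by (rule DERIV_imp_deriv, rule DERIV_add) (rule DERIV_tdpart assms)+

lemma tdpart_mult:
  assumes "F differentiable (at z)" "G differentiable (at z)"
  shows "tdpart a (\<lambda>y. F y * G y) z = tdpart a F z * G z + F z * tdpart a G z"
  unfolding tdpart_eq_deriv[of a "\<lambda>y. F y * G y"]
  using DERIV_mult[OF DERIV_tdpart(1)[OF assms(1), of a] DERIV_tdpart(1)[OF assms(2), of a]]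
  by (intro DERIV_imp_deriv) (simp add: mult.commute)

lemma tdpart_const: "tdpart a (\<lambda>y. c) = (\<lambda>z. 0)"
  by (simp add: tdpart_eq_deriv fun_eq_iff)

fun tderivs :: "'n::finite option list \<Rightarrow> ((real^'n) \<times> real \<Rightarrow> real) \<Rightarrow> (real^'n) \<times> real \<Rightarrow> real" where
  "tderivs [] F = F"
| "tderivs (a # xs) F = tderivs xs (tdpart a F)"

text \<open>\<open>D\<close> contains its initial time slice and is in general not open. Smoothness
  therefore refers to an open set \<open>W\<close> around it, while equations are compared on
  \<open>D\<close> only.\<close>

locale flow_region =
  fixes W :: "((real^'n::finite) \<times> real) set" and U :: "(real^'n) set" and T :: real
  assumes open_W: "open W" and open_U: "open U" and region_subset: "U \<times> {0..<T} \<subseteq> W"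
begin

abbreviation D :: "((real^'n) \<times> real) set" where "D \<equiv> U \<times> {0..<T}"

abbreviation smooth :: "((real^'n) \<times> real \<Rightarrow> real) \<Rightarrow> bool" where "smooth \<equiv> Cinf_on W"

lemma D_W: "z \<in> D \<Longrightarrow> z \<in> W"
  using region_subset by blast

text \<open>At time 0 only the forward half of the time axis lies in \<open>D\<close>, but a two-sided derivative
  is already determined by it.\<close>

lemma tdpart_cong:
  assumes F: "smooth F" and G: "smooth G" and eq: "\<And>z. z \<in> D \<Longrightarrow> F z = G z" and z: "z \<in> D"
  shows "tdpart a F z = tdpart a G z"
proof -
  obtain x t where xt: "z = (x, t)" "x \<in> U" "0 \<le> t" "t < T" using z by auto
  obtain d where d: "d > 0" "\<And>y. dist y x < d \<Longrightarrow> y \<in> U"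
    using open_U xt(2) unfolding open_dist by blast
  define e where "e = min d (T - t)"
  have e: "e > 0" using d xt by (simp add: e_def)
  have in_D: "z + s *\<^sub>R tdir a \<in> D" if "0 \<le> s" "s < e" for s
  proof (cases a)
    case None
    then show ?thesis using that xt by (auto simp: tdir_def e_def)
  next
    case (Some i)
    have "x + s *\<^sub>R axis i 1 \<in> U"
      using that by (intro d(2)) (simp add: dist_norm e_def)
    then show ?thesis using Some xt by (auto simp: tdir_def)
  qed
  have "((\<lambda>s. F (z + s *\<^sub>R tdir a) - G (z + s *\<^sub>R tdir a)) has_field_derivative
      (tdpart a F z - tdpart a G z)) (at 0)"
    using F G z by (intro DERIV_diff DERIV_tdpart(1) Cinf_on_differentiable[of W]) (auto simp: D_W)
  then have lim: "((\<lambda>s. (F (z + s *\<^sub>R tdir a) - G (z + s *\<^sub>R tdir a)) / s) \<longlongrightarrow>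
      tdpart a F z - tdpart a G z) (at_right 0)"
    using eq[OF z] by (auto simp: DERIV_def intro: filterlim_mono[OF _ order_refl] at_le)
  have "eventually (\<lambda>s. (F (z + s *\<^sub>R tdir a) - G (z + s *\<^sub>R tdir a)) / s = 0) (at_right 0)"
    using e eq[OF in_D] by (auto simp: eventually_at_right_field intro!: exI[of _ e])
  from lim[unfolded tendsto_cong[OF this]]
  have "((\<lambda>s. 0) \<longlongrightarrow> tdpart a F z - tdpart a G z) (at_right (0::real))" .
  from tendsto_unique[OF _ this tendsto_const] show ?thesis
    by simp
qed

text \<open>\<open>tdpart_cong\<close> returns equality on all of \<open>D\<close>, so it applies
  again to the next derivative.\<close>

lemma tderivs_cong:
  "smooth F \<Longrightarrow> smooth G \<Longrightarrow> (\<And>z. z \<in> D \<Longrightarrow> F z = G z) \<Longrightarrow> z \<in> D \<Longrightarrow> tderivs xs F z = tderivs xs G z"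
proof (induction xs arbitrary: F G)
  case (Cons a xs)
  then show ?case
    by (simp only: tderivs.simps) (intro Cons.IH Cinf_on_tdpart[OF open_W] tdpart_cong, blast+)
qed simp

lemma tderivs_add:
  "smooth F \<Longrightarrow> smooth G \<Longrightarrow> z \<in> D \<Longrightarrow> tderivs xs (\<lambda>y. F y + G y) z = tderivs xs F z + tderivs xs G z"
proof (induction xs arbitrary: F G)
  case (Cons a xs)
  have "tderivs xs (tdpart a (\<lambda>y. F y + G y)) z = tderivs xs (\<lambda>y. tdpart a F y + tdpart a G y) z"
    using Cons.prems
    by (intro tderivs_cong)
      (auto intro!: Cinf_on_tdpart Cinf_on_add open_W tdpart_add Cinf_on_differentiable[of W] simp: D_W)
  then show ?case using Cons by (simp add: Cinf_on_tdpart open_W)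
qed simp

lemma tderivs_mult:
  "smooth F \<Longrightarrow> smooth G \<Longrightarrow> z \<in> D \<Longrightarrow>
    tderivs xs (\<lambda>y. F y * G y) z = leibniz (\<lambda>xs. tderivs xs F z) (\<lambda>xs. tderivs xs G z) xs"
proof (induction xs arbitrary: F G)
  case (Cons a xs)
  have "tderivs xs (tdpart a (\<lambda>y. F y * G y)) z
      = tderivs xs (\<lambda>y. tdpart a F y * G y + F y * tdpart a G y) z"
    using Cons.prems
    by (intro tderivs_cong)
      (auto intro!: Cinf_on_tdpart Cinf_on_add Cinf_on_mult open_W tdpart_mult
        Cinf_on_differentiable[of W] simp: D_W)
  then show ?case
    using Cons by (simp add: Cinf_on_tdpart Cinf_on_mult tderivs_add open_W shift_def)
qed simp

lemma tderivs_const: "tderivs xs (\<lambda>y. c) z = (if xs = [] then c else 0)"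
  by (induction xs arbitrary: c) (auto simp: tdpart_const)

lemma tderivs_swap:
  "smooth F \<Longrightarrow> z \<in> D \<Longrightarrow> tderivs (xs @ a # b # ys) F z = tderivs (xs @ b # a # ys) F z"
proof (induction xs arbitrary: F)
  case Nil
  then show ?case
    by (auto intro!: tderivs_cong Cinf_on_tdpart open_W tdpart_commute[OF open_W] D_W)
next
  case (Cons c xs)
  then show ?case by (simp add: Cinf_on_tdpart open_W)
qed

end

section \<open>Jets of smooth functions at a point\<close>

locale flow_region_point = flow_region W U T
  for W :: "((real^'n::finite) \<times> real) set" and U T +
  fixes z :: "(real^'n) \<times> real"
  assumes z: "z \<in> D"
begin

text \<open>Meaningful for smooth \<open>F\<close>: only then is the family of derivatives known to
  be symmetric, as \<open>Jet\<close> requires.\<close>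

definition J :: "((real^'n) \<times> real \<Rightarrow> real) \<Rightarrow> 'n option jet" where
  "J F = Jet (\<lambda>xs. tderivs xs F z)"

lemma coeff_J: "smooth F \<Longrightarrow> coeff_jet (J F) = (\<lambda>xs. tderivs xs F z)"
  unfolding J_def using z by (subst Jet_inverse) (auto simp: sym_jet_def tderivs_swap)

lemma J_eqI: "smooth F \<Longrightarrow> (\<And>xs. tderivs xs F z = coeff_jet j xs) \<Longrightarrow> J F = j"
  by (simp add: coeff_jet_inject[symmetric] coeff_J fun_eq_iff)

lemma J_value: "smooth F \<Longrightarrow> coeff_jet (J F) [] = F z"
  by (simp add: coeff_J)

text \<open>Equality on \<open>D\<close> fixes all derivatives at \<open>z\<close>, so the flow
  equation becomes an equation in the jet ring and may be differentiated there.\<close>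

lemma J_cong: "smooth F \<Longrightarrow> smooth G \<Longrightarrow> (\<And>y. y \<in> D \<Longrightarrow> F y = G y) \<Longrightarrow> J F = J G"
  using z by (intro J_eqI) (auto simp: coeff_J intro: tderivs_cong)

lemma J_add: "smooth F \<Longrightarrow> smooth G \<Longrightarrow> J (\<lambda>y. F y + G y) = J F + J G"
  using z by (intro J_eqI) (auto simp: coeff_J tderivs_add plus_jet.rep_eq intro: Cinf_on_add open_W)

lemma J_mult: "smooth F \<Longrightarrow> smooth G \<Longrightarrow> J (\<lambda>y. F y * G y) = J F * J G"
  using z by (intro J_eqI)
    (auto simp: tderivs_mult times_jet.rep_eq coeff_J intro: Cinf_on_mult open_W)

lemma J_0: "J (\<lambda>y. 0) = 0" and J_1: "J (\<lambda>y. 1) = 1"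
  by (auto intro!: J_eqI Cinf_on_const simp: tderivs_const zero_jet.rep_eq one_jet.rep_eq)

lemma J_uminus: "smooth F \<Longrightarrow> J (\<lambda>y. - F y) = - J F"
  using J_add[of F "\<lambda>y. - F y"] by (simp add: Cinf_on_uminus open_W J_0 eq_neg_iff_add_eq_0 add.commute)

lemma J_diff: "smooth F \<Longrightarrow> smooth G \<Longrightarrow> J (\<lambda>y. F y - G y) = J F - J G"
  using J_add[of F "\<lambda>y. - G y"] by (simp add: Cinf_on_uminus open_W J_uminus)

lemma J_sum: "(\<And>i. i \<in> I \<Longrightarrow> smooth (F i)) \<Longrightarrow> J (\<lambda>y. \<Sum>i\<in>I. F i y) = (\<Sum>i\<in>I. J (F i))"
  by (induction I rule: infinite_finite_induct) (auto simp: J_0 J_add Cinf_on_sum open_W)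

lemma J_tdpart: "smooth F \<Longrightarrow> J (tdpart a F) = jet_deriv a (J F)"
  by (intro J_eqI) (auto simp: coeff_J jet_deriv.rep_eq shift_def Cinf_on_tdpart open_W)

end

section \<open>Tensor calculus over a ring with derivations\<close>

lemma sum_swap3:
  "(\<Sum>k\<in>C. \<Sum>i\<in>A. \<Sum>l\<in>B. F i l k) = (\<Sum>i\<in>A. \<Sum>l\<in>B. \<Sum>k\<in>C. F i l k)"
  by (subst sum.swap, intro sum.cong refl, rule sum.swap)

text \<open>\<open>Om a j l\<close> is the coefficient of \<open>e l\<close> in the derivative of \<open>e j\<close> in direction \<open>a\<close>, where \<open>None\<close> is
  the time direction; \<open>h\<close> plays the role of 1/2.\<close>

locale metric_connection =
  fixes pd :: "'n::finite option \<Rightarrow> 'a::comm_ring_1 \<Rightarrow> 'a"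
    and g G :: "'n \<Rightarrow> 'n \<Rightarrow> 'a"
    and Om :: "'n option \<Rightarrow> 'n \<Rightarrow> 'n \<Rightarrow> 'a"
    and h :: 'a
  assumes pd_add: "pd a (x + y) = pd a x + pd a y"
    and pd_mult: "pd a (x * y) = pd a x * y + x * pd a y"
    and pd_commute: "pd a (pd b x) = pd b (pd a x)"
    and half: "h + h = 1"
    and g_sym: "g i j = g j i"
    and G_sym: "G i j = G j i"
    and G_g: "(\<Sum>k\<in>UNIV. G i k * g k j) = (if i = j then 1 else 0)"
    and torsion_free: "Om (Some i) j k = Om (Some j) i k"
    and metric: "pd a (g i j) = (\<Sum>m\<in>UNIV. Om a i m * g m j) + (\<Sum>m\<in>UNIV. Om a j m * g i m)"
begin

text \<open>Multiplying \<open>x + x\<close> by \<open>h\<close> returns \<open>x\<close>; this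
  replaces division by 2.\<close>

lemma no_2_torsion: "x + x = 0 \<Longrightarrow> x = (0::'a)"
  by (metis distrib_left distrib_right half mult_1 mult_zero_right)

lemma pd_0 [simp]: "pd a 0 = 0"
  using pd_add[of a 0 0] by simp

lemma pd_1 [simp]: "pd a 1 = 0"
  using pd_mult[of a 1 1] by simp

lemma pd_uminus: "pd a (- x) = - pd a x"
  using pd_add[of a x "- x"] by (simp add: eq_neg_iff_add_eq_0 add.commute)

lemma pd_diff: "pd a (x - y) = pd a x - pd a y"
  using pd_add[of a x "- y"] by (simp add: pd_uminus)

lemma pd_sum: "pd a (\<Sum>i\<in>I. f i) = (\<Sum>i\<in>I. pd a (f i))"
  by (induction I rule: infinite_finite_induct) (auto simp: pd_add)

lemma pd_h [simp]: "pd a h = 0"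
  using pd_add[of a h h] by (simp add: half no_2_torsion)

section \<open>Covariant derivatives and the inner product\<close>

definition nab :: "'n option \<Rightarrow> 'a^'n \<Rightarrow> 'a^'n" where
  "nab a V = (\<chi> l. pd a (V $ l) + (\<Sum>m\<in>UNIV. Om a m l * V $ m))"

definition e :: "'n \<Rightarrow> 'a^'n" where "e k = axis k 1"

definition ip :: "'a^'n \<Rightarrow> 'a^'n \<Rightarrow> 'a" where
  "ip V W = (\<Sum>i\<in>UNIV. \<Sum>j\<in>UNIV. g i j * V $ i * W $ j)"

lemma e_component: "e k $ l = (if l = k then 1 else 0)"
  by (simp add: e_def axis_def)

lemma basis_expansion: "V = (\<Sum>k\<in>UNIV. V $ k *s e k)"
  by (simp add: vec_eq_iff e_component if_distrib cong: if_cong)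

lemma nab_add: "nab a (V + W) = nab a V + nab a W"
  by (simp add: vec_eq_iff nab_def pd_add algebra_simps sum.distrib)

lemma nab_smult: "nab a (c *s V) = pd a c *s V + c *s nab a V"
  by (simp add: vec_eq_iff nab_def pd_mult algebra_simps sum_distrib_left)

lemma nab_0 [simp]: "nab a 0 = 0"
  by (simp add: vec_eq_iff nab_def)

lemma nab_uminus: "nab a (- V) = - nab a V"
  using nab_add[of a V "- V"] by (simp add: eq_neg_iff_add_eq_0 add.commute)

lemma nab_diff: "nab a (V - W) = nab a V - nab a W"
  using nab_add[of a V "- W"] by (simp add: nab_uminus)

lemma nab_sum: "nab a (\<Sum>i\<in>I. f i) = (\<Sum>i\<in>I. nab a (f i))"
  by (induction I rule: infinite_finite_induct) (auto simp: nab_add)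

lemma nab_e_component: "nab a (e k) $ l = Om a k l"
  by (simp add: nab_def e_component if_distrib cong: if_cong)

lemma nab_e: "nab a (e k) = (\<Sum>l\<in>UNIV. Om a k l *s e l)"
  using basis_expansion[of "nab a (e k)"] by (simp add: nab_e_component)

lemma nab_e_commute: "nab (Some i) (e j) = nab (Some j) (e i)"
  by (simp add: vec_eq_iff nab_e_component torsion_free)

lemma pd_component: "pd a (V $ l) = nab a V $ l - (\<Sum>m\<in>UNIV. Om a m l * V $ m)"
  by (simp add: nab_def)

lemma ip_add_left: "ip (V + V') W = ip V W + ip V' W"
  by (simp add: ip_def algebra_simps sum.distrib)

lemma ip_smult_left: "ip (c *s V) W = c * ip V W"
  by (simp add: ip_def algebra_simps sum_distrib_left)

lemma ip_commute: "ip V W = ip W V"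
  unfolding ip_def by (subst sum.swap) (simp add: g_sym mult.commute mult.left_commute)

lemma ip_0_left [simp]: "ip 0 W = 0"
  by (simp add: ip_def)

lemma ip_uminus_left: "ip (- V) W = - ip V W"
  by (simp add: ip_def sum_negf)

lemma ip_diff_left: "ip (V - V') W = ip V W - ip V' W"
  using ip_add_left[of V "- V'" W] by (simp add: ip_uminus_left)

lemma ip_sum_left: "ip (\<Sum>i\<in>I. f i) W = (\<Sum>i\<in>I. ip (f i) W)"
  by (induction I rule: infinite_finite_induct) (auto simp: ip_add_left)

lemma ip_add_right: "ip W (V + V') = ip W V + ip W V'"
  and ip_smult_right: "ip W (c *s V) = c * ip W V"
  and ip_0_right [simp]: "ip W 0 = 0"
  and ip_uminus_right: "ip W (- V) = - ip W V"
  and ip_diff_right: "ip W (V - V') = ip W V - ip W V'"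
  and ip_sum_right: "ip W (\<Sum>i\<in>I. f i) = (\<Sum>i\<in>I. ip W (f i))"
  by (simp_all add: ip_commute[of W] ip_add_left ip_smult_left ip_uminus_left ip_diff_left ip_sum_left)

lemmas ip_linear = ip_add_left ip_smult_left ip_uminus_left ip_diff_left ip_sum_left
  ip_add_right ip_smult_right ip_uminus_right ip_diff_right ip_sum_right

lemmas nab_linear = nab_add nab_smult nab_uminus nab_diff nab_sum

lemma ip_e_right: "ip V (e k) = (\<Sum>i\<in>UNIV. g i k * V $ i)"
  by (simp add: ip_def e_component if_distrib cong: if_cong)

lemma ip_expand_right: "ip W V = (\<Sum>k\<in>UNIV. V $ k * ip W (e k))"
  by (subst basis_expansion[of V]) (simp add: ip_linear)

text \<open>Lowering and then raising an index recovers the vector. Hence inner products with the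
  frame determine a vector, and later identities are tested on them.\<close>

lemma component_ip: "V $ l = (\<Sum>k\<in>UNIV. G l k * ip V (e k))"
proof -
  have "(\<Sum>k\<in>UNIV. G l k * ip V (e k)) = (\<Sum>k\<in>UNIV. \<Sum>i\<in>UNIV. (G l k * g k i) * V $ i)"
    by (simp add: ip_e_right sum_distrib_left g_sym mult.assoc)
  also have "\<dots> = (\<Sum>i\<in>UNIV. (\<Sum>k\<in>UNIV. G l k * g k i) * V $ i)"
    by (subst sum.swap) (simp add: sum_distrib_right)
  also have "\<dots> = V $ l"
    by (simp add: G_g if_distrib[of "\<lambda>x. x * _"] cong: if_cong)
  finally show ?thesis by simp
qed

lemma ip_eqI: "(\<And>k. ip V (e k) = ip W (e k)) \<Longrightarrow> V = W"
  by (simp add: vec_eq_iff component_ip)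

lemma g_G: "(\<Sum>k\<in>UNIV. g i k * G k j) = (if i = j then 1 else 0)"
  using G_g[of j i] by (simp add: g_sym[of i] G_sym[of _ j] mult.commute eq_commute)

lemma ip_raise: "ip (\<chi> l. \<Sum>m\<in>UNIV. G l m * w m) (e k) = w k"
proof -
  have "ip (\<chi> l. \<Sum>m\<in>UNIV. G l m * w m) (e k) = (\<Sum>i\<in>UNIV. \<Sum>m\<in>UNIV. (g k i * G i m) * w m)"
    by (simp add: ip_e_right sum_distrib_left g_sym[of _ k] mult.assoc)
  also have "\<dots> = (\<Sum>m\<in>UNIV. (\<Sum>i\<in>UNIV. g k i * G i m) * w m)"
    by (subst sum.swap) (simp add: sum_distrib_right)
  also have "\<dots> = w k"
    by (simp add: g_G if_distrib[of "\<lambda>x. x * _"] cong: if_cong)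
  finally show ?thesis .
qed

text \<open>The assumption \<open>metric\<close> is the case of two frame vectors; the product rule
  extends it to one slot and then to the other.\<close>

lemma pd_ip: "pd a (ip V W) = ip (nab a V) W + ip V (nab a W)"
proof -
  have basis: "pd a (ip (e i) (e j)) = ip (nab a (e i)) (e j) + ip (e i) (nab a (e j))" for i j
  proof -
    have ee: "ip (e i) (e j) = g i j" for i j
      by (simp add: ip_e_right e_component if_distrib cong: if_cong)
    show ?thesis by (simp add: nab_e ip_linear ee metric)
  qed
  have e: "pd a (ip (e i) W) = ip (nab a (e i)) W + ip (e i) (nab a W)" for i
    by (subst (1 2 3) basis_expansion[of W])
      (simp add: ip_linear nab_linear pd_sum pd_mult basis sum.distrib algebra_simps)
  show ?thesis
    by (subst (1 2 3) basis_expansion[of V])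
      (simp add: ip_linear nab_linear pd_sum pd_mult e sum.distrib algebra_simps)
qed

section \<open>Curvature and its algebraic symmetries\<close>

definition cur :: "'n option \<Rightarrow> 'n option \<Rightarrow> 'a^'n \<Rightarrow> 'a^'n" where
  "cur a b V = nab a (nab b V) - nab b (nab a V)"

text \<open>Terms with first derivatives of \<open>c\<close> cancel in pairs, those with second
  derivatives because partial derivatives commute.\<close>

lemma cur_smult: "cur a b (c *s V) = c *s cur a b V"
  by (simp add: vec_eq_iff cur_def nab_linear pd_commute[of a b] algebra_simps)

lemma cur_sum: "cur a b (\<Sum>i\<in>I. f i) = (\<Sum>i\<in>I. cur a b (f i))"
  by (simp add: cur_def nab_linear sum_subtractf)

lemma cur_expand: "cur a b V = (\<Sum>k\<in>UNIV. V $ k *s cur a b (e k))"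
  by (subst basis_expansion[of V]) (simp only: cur_sum cur_smult)

lemma cur_antisym: "cur b a V = - cur a b V"
  by (simp add: cur_def)

lemma cur_component:
  "cur a b (e k) $ l = pd a (Om b k l) - pd b (Om a k l)
     + (\<Sum>m\<in>UNIV. Om b k m * Om a m l - Om a k m * Om b m l)"
proof -
  have "nab a (nab b (e k)) $ l = pd a (Om b k l) + (\<Sum>m\<in>UNIV. Om b k m * Om a m l)" for a b
    by (simp add: nab_def[of a] nab_e_component mult.commute)
  then show ?thesis by (simp add: cur_def sum_subtractf)
qed

text \<open>The commutator of \<open>pd a\<close> and \<open>pd b\<close> on \<open>ip V W\<close>
  vanishes, and in its expansion the terms with one derivative on each factor cancel. Time is
  allowed as a direction, which the Koszul argument uses.\<close>

lemma cur_skew: "ip (cur a b V) W = - ip V (cur a b W)"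
proof -
  have "pd a (pd b (ip V W)) - pd b (pd a (ip V W)) = 0"
    by (simp add: pd_commute)
  then show ?thesis
    by (simp add: pd_ip pd_add cur_def ip_linear algebra_simps)
qed

lemma bianchi1:
  "cur (Some i) (Some j) (e k) + cur (Some j) (Some k) (e i) + cur (Some k) (Some i) (e j) = 0"
  by (simp add: cur_def nab_e_commute[of k j] nab_e_commute[of i k] nab_e_commute[of j i])

definition Rm :: "'n \<Rightarrow> 'n \<Rightarrow> 'n \<Rightarrow> 'n \<Rightarrow> 'a" where
  "Rm i j k l = ip (cur (Some i) (Some j) (e k)) (e l)"

lemma Rm_antisym: "Rm j i k l = - Rm i j k l"
  by (simp add: Rm_def cur_antisym[of "Some j"] ip_linear)

lemma Rm_skew: "Rm i j l k = - Rm i j k l"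
  unfolding Rm_def by (metis cur_skew ip_commute)

lemma Rm_bianchi: "Rm i j k l + Rm j k i l + Rm k i j l = 0"
  using arg_cong[OF bianchi1[of i j k], of "\<lambda>V. ip V (e l)"] by (simp add: Rm_def ip_linear)

text \<open>Two different uses of the first Bianchi identity give the difference of the two sides
  with opposite signs, so twice the difference is zero.\<close>

lemma Rm_pair: "Rm i j k l = Rm k l i j"
proof -
  have bianchi: "Rm i j k l = - (Rm j k i l + Rm k i j l)" for i j k l
    using Rm_bianchi[of i j k l] unfolding eq_neg_iff_add_eq_0 add.assoc .
  have "Rm i j k l - Rm k l i j = Rm j l k i - Rm k i j l"
    unfolding bianchi[of i j k l]
  proof -
    have "Rm k l i j = - Rm k l j i" "Rm k l j i = - (Rm l j k i + Rm j k l i)"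
      "Rm l j k i = - Rm j l k i" "Rm j k l i = - Rm j k i l"
      by (rule Rm_skew bianchi Rm_antisym)+
    then show "- (Rm j k i l + Rm k i j l) - Rm k l i j = Rm j l k i - Rm k i j l"
      by simp
  qed
  moreover have "Rm i j k l - Rm k l i j = Rm k i j l - Rm j l k i"
  proof -
    have "Rm i j k l = - Rm i j l k" "Rm i j l k = - (Rm j l i k + Rm l i j k)"
      "Rm j l i k = - Rm j l k i" "Rm l i j k = - Rm i l j k"
      by (rule Rm_skew bianchi Rm_antisym)+
    moreover have "Rm k l i j = - (Rm l i k j + Rm i k l j)"
      "Rm l i k j = - Rm l i j k" "Rm i k l j = - Rm i k j l" "Rm i k j l = - Rm k i j l"
      by (rule Rm_skew bianchi Rm_antisym)+
    ultimately show ?thesis by simp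
  qed
  ultimately have "(Rm i j k l - Rm k l i j) + (Rm i j k l - Rm k l i j) = 0"
    by simp
  from no_2_torsion[OF this] show ?thesis by simp
qed

text \<open>A family \<open>s i\<close> of vectors is read as a tensor with one lower index \<open>i\<close> and one upper index;
  \<open>cov k s i\<close> is its covariant derivative in direction \<open>k\<close>. Likewise \<open>cov2\<close> for two lower indices.\<close>

definition cov :: "'n \<Rightarrow> ('n \<Rightarrow> 'a^'n) \<Rightarrow> 'n \<Rightarrow> 'a^'n" where
  "cov k s i = nab (Some k) (s i) - (\<Sum>q\<in>UNIV. Om (Some k) i q *s s q)"

definition cov2 :: "'n \<Rightarrow> ('n \<Rightarrow> 'n \<Rightarrow> 'a^'n) \<Rightarrow> 'n \<Rightarrow> 'n \<Rightarrow> 'a^'n" where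
  "cov2 b S a i = nab (Some b) (S a i) - (\<Sum>q\<in>UNIV. Om (Some b) a q *s S q i)
     - (\<Sum>q\<in>UNIV. Om (Some b) i q *s S a q)"

lemma ip_cov:
  "ip (cov k s i) (e l) = pd (Some k) (ip (s i) (e l)) - (\<Sum>q\<in>UNIV. Om (Some k) i q * ip (s q) (e l))
     - (\<Sum>q\<in>UNIV. Om (Some k) l q * ip (s i) (e q))"
  by (simp add: cov_def ip_linear pd_ip nab_e)

lemma ip_cov2:
  "ip (cov2 b S a i) (e l) = pd (Some b) (ip (S a i) (e l))
     - (\<Sum>q\<in>UNIV. Om (Some b) a q * ip (S q i) (e l))
     - (\<Sum>q\<in>UNIV. Om (Some b) i q * ip (S a q) (e l))
     - (\<Sum>q\<in>UNIV. Om (Some b) l q * ip (S a i) (e q))"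
  by (simp add: cov2_def ip_linear pd_ip nab_e)

text \<open>The connection terms of the upper and the lower index cancel after exchanging the
  summation indices.\<close>

lemma trace_cov: "(\<Sum>i\<in>UNIV. cov k s i $ i) = pd (Some k) (\<Sum>i\<in>UNIV. s i $ i)"
proof -
  have "(\<Sum>i\<in>UNIV. cov k s i $ i) = (\<Sum>i\<in>UNIV. pd (Some k) (s i $ i))
      + ((\<Sum>i\<in>UNIV. \<Sum>m\<in>UNIV. Om (Some k) m i * s i $ m)
      - (\<Sum>i\<in>UNIV. \<Sum>q\<in>UNIV. Om (Some k) i q * s q $ i))"
    by (simp add: cov_def nab_def sum.distrib sum_subtractf)
  also have "(\<Sum>i\<in>UNIV. \<Sum>m\<in>UNIV. Om (Some k) m i * s i $ m)
      = (\<Sum>i\<in>UNIV. \<Sum>q\<in>UNIV. Om (Some k) i q * s q $ i)"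
    by (rule sum.swap)
  finally show ?thesis by (simp add: pd_sum)
qed

lemma trace_cov2:
  "(\<Sum>i\<in>UNIV. cov2 b S i k $ i) = pd (Some b) (\<Sum>i\<in>UNIV. S i k $ i)
     - (\<Sum>q\<in>UNIV. Om (Some b) k q * (\<Sum>i\<in>UNIV. S i q $ i))"
proof -
  have "(\<Sum>i\<in>UNIV. cov2 b S i k $ i) = (\<Sum>i\<in>UNIV. cov b (\<lambda>i. S i k) i $ i)
      - (\<Sum>i\<in>UNIV. \<Sum>q\<in>UNIV. Om (Some b) k q * S i q $ i)"
    by (simp add: cov2_def cov_def sum.distrib sum_subtractf)
  also have "(\<Sum>i\<in>UNIV. \<Sum>q\<in>UNIV. Om (Some b) k q * S i q $ i)
      = (\<Sum>q\<in>UNIV. Om (Some b) k q * (\<Sum>i\<in>UNIV. S i q $ i))"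
    by (subst sum.swap) (simp add: sum_distrib_left)
  finally show ?thesis by (simp add: trace_cov)
qed

lemma cov2_flip: "cov2 b (\<lambda>x y. S y x) i a = cov2 b S a i"
  by (simp add: cov2_def algebra_simps)

lemma cov2_add: "cov2 b (\<lambda>x y. S x y + S' x y) a i = cov2 b S a i + cov2 b S' a i"
  by (simp add: vec_eq_iff cov2_def nab_linear algebra_simps sum.distrib)

lemma cov2_diff: "cov2 b (\<lambda>x y. S x y - S' x y) a i = cov2 b S a i - cov2 b S' a i"
  by (simp add: vec_eq_iff cov2_def nab_linear algebra_simps sum_subtractf)

text \<open>The Ricci identity for one lower and one upper index: one curvature term acts on the
  vector, the other on the lower index.\<close>

lemma cov2_commutator:
  "cov2 i (\<lambda>a. cov a s) k j - cov2 k (\<lambda>a. cov a s) i j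
   = cur (Some i) (Some k) (s j) - (\<Sum>q\<in>UNIV. cur (Some i) (Some k) (e j) $ q *s s q)"
proof -
  \<comment> \<open>Grouped so that the bracketed pair of sums is symmetric in \<open>i\<close> and
    \<open>k\<close>, and the \<open>cov q\<close> sum is too by torsion freeness; both drop out of
    the difference.\<close>
  have expand: "cov2 i (\<lambda>a. cov a s) k j = nab (Some i) (nab (Some k) (s j))
      - (\<Sum>q\<in>UNIV. pd (Some i) (Om (Some k) j q) *s s q)
      - ((\<Sum>q\<in>UNIV. Om (Some k) j q *s nab (Some i) (s q)) + (\<Sum>q\<in>UNIV. Om (Some i) j q *s nab (Some k) (s q)))
      - (\<Sum>q\<in>UNIV. Om (Some i) k q *s cov q s j)
      + (\<Sum>q\<in>UNIV. (\<Sum>m\<in>UNIV. Om (Some i) j m * Om (Some k) m q) *s s q)" for i k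
  proof -
    have "(\<Sum>q\<in>UNIV. Om (Some i) j q *s cov k s q) = (\<Sum>q\<in>UNIV. Om (Some i) j q *s nab (Some k) (s q))
       - (\<Sum>q\<in>UNIV. \<Sum>m\<in>UNIV. (Om (Some i) j q * Om (Some k) q m) *s s m)"
      by (simp add: vec_eq_iff cov_def algebra_simps sum_subtractf sum_distrib_left)
    also have "(\<Sum>q\<in>UNIV. \<Sum>m\<in>UNIV. (Om (Some i) j q * Om (Some k) q m) *s s m)
       = (\<Sum>q\<in>UNIV. (\<Sum>m\<in>UNIV. Om (Some i) j m * Om (Some k) m q) *s s q)"
      by (subst sum.swap) (simp add: vec_eq_iff sum_distrib_right)
    finally show ?thesis
      unfolding cov2_def cov_def[of k s j] nab_linear sum.distrib by (simp add: algebra_simps)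
  qed
  have "(\<Sum>q\<in>UNIV. cur (Some i) (Some k) (e j) $ q *s s q)
    = (\<Sum>q\<in>UNIV. pd (Some i) (Om (Some k) j q) *s s q) - (\<Sum>q\<in>UNIV. pd (Some k) (Om (Some i) j q) *s s q)
     + (\<Sum>q\<in>UNIV. (\<Sum>m\<in>UNIV. Om (Some k) j m * Om (Some i) m q) *s s q)
     - (\<Sum>q\<in>UNIV. (\<Sum>m\<in>UNIV. Om (Some i) j m * Om (Some k) m q) *s s q)"
    by (simp add: vec_eq_iff cur_component algebra_simps sum.distrib sum_subtractf)
  then show ?thesis
    unfolding expand cur_def torsion_free[of k i] by (simp add: algebra_simps)
qed

section \<open>Ricci tensor and scalar curvature\<close>

definition ric :: "'n \<Rightarrow> 'n \<Rightarrow> 'a" where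
  "ric j k = (\<Sum>p\<in>UNIV. cur (Some p) (Some j) (e k) $ p)"

definition Rv :: "'n \<Rightarrow> 'a^'n" where
  "Rv i = (\<chi> l. \<Sum>m\<in>UNIV. G l m * ric i m)"

definition scal :: 'a where "scal = (\<Sum>j\<in>UNIV. Rv j $ j)"

lemma ip_Rv: "ip (Rv i) (e k) = ric i k"
  by (simp add: Rv_def ip_raise)

lemma ric_Rm: "ric j k = (\<Sum>p\<in>UNIV. \<Sum>l\<in>UNIV. G p l * Rm p j k l)"
  by (simp add: ric_def Rm_def component_ip[of "cur _ _ _"])

text \<open>Pair symmetry and the two antisymmetries reverse the four indices of \<open>Rm\<close>;
  this exchanges \<open>j\<close> and \<open>k\<close> and only relabels the trace.\<close>

lemma ric_sym: "ric j k = ric k j"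
proof -
  have "Rm p j k l = Rm l k j p" for p l
    using Rm_pair[of p j k l] Rm_antisym[of k l p j] Rm_skew[of l k p j] by simp
  then have "ric j k = (\<Sum>p\<in>UNIV. \<Sum>l\<in>UNIV. G l p * Rm l k j p)"
    unfolding ric_Rm by (intro sum.cong refl) (simp add: G_sym)
  also have "\<dots> = ric k j"
    unfolding ric_Rm by (rule sum.swap)
  finally show ?thesis .
qed

lemma ip_Rv_right: "ip (Rv j) V = (\<Sum>q\<in>UNIV. V $ q * ric j q)"
  by (simp add: ip_expand_right[of _ V] ip_Rv)

lemma ip_cov_Rv_sym: "ip (cov m Rv i) (e k) = ip (cov m Rv k) (e i)"
  unfolding ip_cov ip_Rv by (subst (1 2 3) ric_sym) (simp add: algebra_simps)

text \<open>The vector \<open>\<nabla>^l R_ik\<close>: here the derivative index is raised, in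
  \<open>cov m Rv i\<close> an index of the Ricci tensor.\<close>

definition Y :: "'n \<Rightarrow> 'n \<Rightarrow> 'a^'n" where
  "Y i k = (\<chi> l. \<Sum>m\<in>UNIV. G l m * ip (cov m Rv i) (e k))"

lemma ip_Y: "ip (Y i k) (e m) = ip (cov m Rv i) (e k)"
  by (simp add: Y_def ip_raise)

definition dv :: "'n \<Rightarrow> 'a" where "dv k = (\<Sum>i\<in>UNIV. cov i Rv k $ i)"

lemma trace_Y: "(\<Sum>i\<in>UNIV. Y i k $ i) = dv k"
proof -
  have "(\<Sum>i\<in>UNIV. Y i k $ i) = (\<Sum>i\<in>UNIV. \<Sum>m\<in>UNIV. G i m * ip (cov m Rv k) (e i))"
    by (simp add: Y_def ip_cov_Rv_sym[of _ _ k])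
  also have "\<dots> = dv k"
    unfolding dv_def component_ip[of "cov _ Rv k"] by (subst sum.swap) (simp add: G_sym)
  finally show ?thesis .
qed

text \<open>The covariant derivative \<open>\<nabla>_p R_ijk\<close> of the curvature tensor, as a
  vector in its upper index.\<close>

definition B :: "'n \<Rightarrow> 'n \<Rightarrow> 'n \<Rightarrow> 'n \<Rightarrow> 'a^'n" where
  "B p i j k = nab (Some p) (cur (Some i) (Some j) (e k)) - cur (Some i) (Some j) (nab (Some p) (e k))
     - (\<Sum>q\<in>UNIV. Om (Some p) i q *s cur (Some q) (Some j) (e k))
     - (\<Sum>q\<in>UNIV. Om (Some p) j q *s cur (Some i) (Some q) (e k))"

lemma B_antisym: "B p j i k = - B p i j k"
  by (simp add: B_def cur_antisym[of "Some j"] cur_antisym[of _ "Some i"]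
      nab_uminus vec_eq_iff sum_negf)

text \<open>The Jacobi identity for the operators \<open>nab\<close>, applied to \<open>e k\<close>;
  the connection terms on the first two curvature indices cancel by torsion freeness and
  antisymmetry.\<close>

lemma bianchi2: "B p i j k + B i j p k + B j p i k = 0"
proof -
  have jacobi: "nab (Some p) (cur (Some i) (Some j) V) - cur (Some i) (Some j) (nab (Some p) V)
     + (nab (Some i) (cur (Some j) (Some p) V) - cur (Some j) (Some p) (nab (Some i) V))
     + (nab (Some j) (cur (Some p) (Some i) V) - cur (Some p) (Some i) (nab (Some j) V)) = 0" for V
    by (simp add: cur_def nab_linear)
  have anti: "(\<Sum>q\<in>UNIV. c q *s cur (Some q) (Some j) V) = - (\<Sum>q\<in>UNIV. c q *s cur (Some j) (Some q) V)" for c j V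
    by (simp add: cur_antisym[of "Some j"] vec_eq_iff sum_negf)
  show ?thesis
    using jacobi[of "e k"]
    by (simp add: B_def anti torsion_free[of p] torsion_free[of j i] algebra_simps)
qed

lemma B_skew: "ip (B p i j k) (e l) = - ip (B p i j l) (e k)"
proof -
  have "ip (nab (Some p) (cur (Some i) (Some j) (e k)) - cur (Some i) (Some j) (nab (Some p) (e k))) (e l)
    + ip (e k) (nab (Some p) (cur (Some i) (Some j) (e l)) - cur (Some i) (Some j) (nab (Some p) (e l))) = 0"
    using arg_cong[OF cur_skew[of "Some i" "Some j" "e k" "e l"], of "pd (Some p)"]
    by (simp add: pd_ip pd_uminus ip_linear cur_skew[of _ _ "nab _ _"] cur_skew[of _ _ "e k" "nab _ _"] algebra_simps)
  then have "ip (nab (Some p) (cur (Some i) (Some j) (e k)) - cur (Some i) (Some j) (nab (Some p) (e k))) (e l)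
    = - ip (nab (Some p) (cur (Some i) (Some j) (e l)) - cur (Some i) (Some j) (nab (Some p) (e l))) (e k)"
    by (simp add: ip_commute[of "e k"] eq_neg_iff_add_eq_0)
  moreover have "ip (cur a b (e k)) (e l) = - ip (cur a b (e l)) (e k)" for a b
    by (metis cur_skew ip_commute)
  ultimately show ?thesis
    by (simp add: B_def ip_diff_left ip_sum_left ip_smult_left sum_negf)
qed

lemma trace_B: "(\<Sum>i\<in>UNIV. B p i j k $ i) = ip (cov p Rv j) (e k)"
proof -
  have "(\<Sum>i\<in>UNIV. B p i j k $ i) = (\<Sum>i\<in>UNIV. cov p (\<lambda>i. cur (Some i) (Some j) (e k)) i $ i)
     - (\<Sum>i\<in>UNIV. \<Sum>q\<in>UNIV. Om (Some p) k q * cur (Some i) (Some j) (e q) $ i)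
     - (\<Sum>i\<in>UNIV. \<Sum>q\<in>UNIV. Om (Some p) j q * cur (Some i) (Some q) (e k) $ i)"
    by (simp add: B_def cov_def nab_e cur_sum cur_smult sum_subtractf)
  also have "(\<Sum>i\<in>UNIV. \<Sum>q\<in>UNIV. Om (Some p) k q * cur (Some i) (Some j) (e q) $ i)
     = (\<Sum>q\<in>UNIV. Om (Some p) k q * ric j q)"
    by (subst sum.swap) (simp add: ric_def sum_distrib_left)
  also have "(\<Sum>i\<in>UNIV. \<Sum>q\<in>UNIV. Om (Some p) j q * cur (Some i) (Some q) (e k) $ i)
     = (\<Sum>q\<in>UNIV. Om (Some p) j q * ric q k)"
    by (subst sum.swap) (simp add: ric_def sum_distrib_left)
  finally show ?thesis
    by (simp add: trace_cov ip_cov ip_Rv ric_def[symmetric])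
qed

text \<open>Two traces of the second Bianchi identity.\<close>

lemma contracted_bianchi: "pd (Some p) scal = dv p + dv p"
proof -
  let ?b = "\<lambda>p i j k l. ip (B p i j k) (e l)"
  have tr: "(\<Sum>i\<in>UNIV. \<Sum>l\<in>UNIV. G i l * ?b p i j k l) = ip (cov p Rv j) (e k)" for p j k
    by (simp add: trace_B[symmetric] component_ip[of "B _ _ _ _"])
  have dv: "(\<Sum>i\<in>UNIV. \<Sum>l\<in>UNIV. G i l * ip (cov i Rv k) (e l)) = dv k" for k
    by (simp add: dv_def component_ip[of "cov _ _ _"])
  \<comment> \<open>The indices are placed so that the first term on the right can be traced over
    \<open>j\<close> and \<open>k\<close>, the second over \<open>i\<close> and \<open>l\<close>,
    each giving a derivative of the Ricci tensor.\<close>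
  have eq: "?b p i j k l = ?b i j p l k + ?b j i p k l" for i j k l
  proof -
    have "?b p i j k l + ?b i j p k l + ?b j p i k l = 0"
      using arg_cong[OF bianchi2, of "\<lambda>V. ip V (e l)"] by (simp add: ip_linear)
    then show ?thesis
      using B_skew[of i j p k l] B_antisym[of j p i k]
      by (simp add: ip_uminus_left algebra_simps)
  qed
  have "pd (Some p) scal = (\<Sum>j\<in>UNIV. \<Sum>k\<in>UNIV. G j k * (\<Sum>i\<in>UNIV. \<Sum>l\<in>UNIV. G i l * ?b p i j k l))"
    by (simp add: tr scal_def trace_cov[symmetric] component_ip[of "cov _ _ _"])
  also have "\<dots> = (\<Sum>j\<in>UNIV. \<Sum>k\<in>UNIV. \<Sum>i\<in>UNIV. \<Sum>l\<in>UNIV. G i l * (G j k * ?b i j p l k))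
      + (\<Sum>j\<in>UNIV. \<Sum>k\<in>UNIV. G j k * (\<Sum>i\<in>UNIV. \<Sum>l\<in>UNIV. G i l * ?b j i p k l))"
    unfolding eq by (simp add: sum_distrib_left sum.distrib algebra_simps)
  also have "(\<Sum>j\<in>UNIV. \<Sum>k\<in>UNIV. \<Sum>i\<in>UNIV. \<Sum>l\<in>UNIV. G i l * (G j k * ?b i j p l k))
      = (\<Sum>i\<in>UNIV. \<Sum>l\<in>UNIV. G i l * (\<Sum>j\<in>UNIV. \<Sum>k\<in>UNIV. G j k * ?b i j p l k))"
  proof -
    have "(\<Sum>j\<in>UNIV. \<Sum>k\<in>UNIV. \<Sum>i\<in>UNIV. \<Sum>l\<in>UNIV. F i l j k) = (\<Sum>i\<in>UNIV. \<Sum>l\<in>UNIV. \<Sum>j\<in>UNIV. \<Sum>k\<in>UNIV. F i l j k)"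
      for F :: "'n \<Rightarrow> 'n \<Rightarrow> 'n \<Rightarrow> 'n \<Rightarrow> 'a"
      by (rule trans[OF sum.cong[OF refl sum_swap3] sum_swap3])
    then show ?thesis by (simp add: sum_distrib_left)
  qed
  finally show ?thesis by (simp add: tr dv)
qed

text \<open>The mixed curvature is determined like the Levi-Civita connection by Koszul's formula: it is
  skew in its last two indices, and its antisymmetrization in the first two is known.\<close>

lemma mixed_curvature_koszul:
  assumes S: "S = (\<lambda>m. nab None (e m))" and S_sym: "\<And>i j. ip (S i) (e j) = ip (S j) (e i)"
  shows "ip (cur (Some i) None (e k)) (e l) = ip (cov l S i) (e k) - ip (cov k S i) (e l)"
proof -
  have c_sym: "ip (cov m S i) (e k) = ip (cov m S k) (e i)" for m i k
    unfolding ip_cov by (subst (1 2 3) S_sym) (simp add: algebra_simps)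
  \<comment> \<open>The failure of the claimed formula. It is symmetric in its first two indices and
    skew in its last two, and six alternating exchanges give \<open>d = - d\<close>.\<close>
  define d where "d i k l = ip (cur (Some i) None (e k)) (e l) - (ip (cov l S i) (e k) - ip (cov k S i) (e l))"
    for i k l
  have skew: "d i k l = - d i l k" for i k l
  proof -
    have "ip (cur (Some i) None (e k)) (e l) = - ip (cur (Some i) None (e l)) (e k)"
      by (metis cur_skew ip_commute)
    then show ?thesis by (simp add: d_def)
  qed
  have sym: "d i k l = d k i l" for i k l
  proof -
    \<comment> \<open>Time derivatives of the connection cancel here, because
      \<open>nab (Some i) (e k)\<close> is symmetric in \<open>i\<close> and
      \<open>k\<close>.\<close>
    have "cur (Some i) None (e k) - cur (Some k) None (e i) = cov i S k - cov k S i"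
      by (simp add: cur_def cov_def S nab_e_commute[of k i] torsion_free[of k i])
    from arg_cong[OF this, of "\<lambda>V. ip V (e l)"]
    have "ip (cur (Some i) None (e k)) (e l) - ip (cur (Some k) None (e i)) (e l)
        = ip (cov i S k) (e l) - ip (cov k S i) (e l)"
      by (simp add: ip_linear)
    then have "ip (cur (Some i) None (e k)) (e l)
        = ip (cur (Some k) None (e i)) (e l) + ip (cov i S k) (e l) - ip (cov k S i) (e l)"
      by (simp add: algebra_simps)
    then show ?thesis
      using c_sym[of l i k] by (simp add: d_def)
  qed
  have "d i k l = d k i l" "d k i l = - d k l i" "d k l i = d l k i" "d l k i = - d l i k"
    "d l i k = d i l k" "d i l k = - d i k l"
    by (rule skew sym)+
  then have "d i k l + d i k l = 0" by simp
  then have "d i k l = 0" by (rule no_2_torsion)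
  then show ?thesis by (simp add: d_def)
qed

section \<open>Gradients and Hessians\<close>

definition grad :: "'a \<Rightarrow> 'a^'n" where
  "grad \<phi> = (\<chi> k. \<Sum>l\<in>UNIV. G k l * pd (Some l) \<phi>)"

lemma ip_grad: "ip (grad \<phi>) (e k) = pd (Some k) \<phi>"
  by (simp add: grad_def ip_raise)

lemma hess_sym: "ip (nab (Some i) (grad \<phi>)) (e j) = ip (nab (Some j) (grad \<phi>)) (e i)"
proof -
  have "ip (nab (Some i) (grad \<phi>)) (e j)
      = pd (Some i) (pd (Some j) \<phi>) - ip (grad \<phi>) (nab (Some i) (e j))" for i j
    using pd_ip[of "Some i" "grad \<phi>" "e j"] by (simp add: ip_grad)
  then show ?thesis by (simp add: pd_commute nab_e_commute[of i j])
qed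

text \<open>By symmetry of the Hessian the left side is a commutator of two covariant derivatives of
  the gradient, hence curvature acting on it.\<close>

lemma hess_commutator:
  "ip (cov l (\<lambda>m. nab (Some m) (grad \<phi>)) i) (e k) - ip (cov k (\<lambda>m. nab (Some m) (grad \<phi>)) i) (e l)
    = (\<Sum>p\<in>UNIV. grad \<phi> $ p * Rm i p k l)"
proof -
  let ?H = "\<lambda>m. nab (Some m) (grad \<phi>)"
  have c_sym: "ip (cov m ?H i) (e k) = ip (cov m ?H k) (e i)" for m i k
    unfolding ip_cov by (subst (1 2 3) hess_sym) (simp add: algebra_simps)
  have Rm: "Rm l k p i = Rm i p k l" for p
    using Rm_pair[of l k p i] Rm_antisym[of i p l k] Rm_skew[of i p l k] by simp
  have "cov l ?H k - cov k ?H l = cur (Some l) (Some k) (grad \<phi>)"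
    by (simp add: cov_def cur_def torsion_free[of l k])
  then have "ip (cov l ?H k) (e i) - ip (cov k ?H l) (e i) = ip (cur (Some l) (Some k) (grad \<phi>)) (e i)"
    by (simp flip: ip_diff_left)
  also have "\<dots> = (\<Sum>p\<in>UNIV. grad \<phi> $ p * Rm l k p i)"
    by (subst cur_expand) (simp add: ip_linear Rm_def)
  finally show ?thesis
    by (simp add: c_sym[of _ i] Rm)
qed

text \<open>The contraction of curvature with the Ricci tensor; its double is the reaction term of
  the Ricci evolution.\<close>

definition Z :: "'n \<Rightarrow> 'n \<Rightarrow> 'a" where
  "Z j k = (\<Sum>p\<in>UNIV. \<Sum>q\<in>UNIV. Rv q $ p * cur (Some p) (Some j) (e k) $ q)"

text \<open>The argument of \<open>ric_sym\<close>, with the Ricci tensor raised in both indices,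
  \<open>T\<close>, in place of \<open>G\<close>.\<close>

lemma Z_sym: "Z j k = Z k j"
proof -
  define T where "T p l = (\<Sum>q\<in>UNIV. \<Sum>m\<in>UNIV. G p m * ric q m * G q l)" for p l
  have T_sym: "T p l = T l p" for p l
    unfolding T_def by (subst sum.swap) (simp add: ric_sym G_sym mult.commute mult.left_commute)
  have Z: "Z j k = (\<Sum>p\<in>UNIV. \<Sum>l\<in>UNIV. T p l * Rm p j k l)" for j k
  proof -
    have "(\<Sum>q\<in>UNIV. Rv q $ p * cur (Some p) (Some j) (e k) $ q)
       = (\<Sum>q\<in>UNIV. \<Sum>l\<in>UNIV. Rv q $ p * G q l * Rm p j k l)" for p
      by (simp add: component_ip[of "cur _ _ _"] Rm_def sum_distrib_left mult.assoc)
    also have "\<dots> p = (\<Sum>l\<in>UNIV. T p l * Rm p j k l)" for p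
      by (subst sum.swap) (simp add: T_def Rv_def sum_distrib_right)
    finally show ?thesis by (simp add: Z_def)
  qed
  have "Rm p j k l = Rm l k j p" for p l
    using Rm_pair[of p j k l] Rm_antisym[of k l p j] Rm_skew[of l k p j] by simp
  then have "Z j k = (\<Sum>p\<in>UNIV. \<Sum>l\<in>UNIV. T l p * Rm l k j p)"
    unfolding Z by (intro sum.cong refl) (simp add: T_sym)
  also have "\<dots> = Z k j"
    unfolding Z by (rule sum.swap)
  finally show ?thesis .
qed

section \<open>Divergences of derivatives of the Ricci tensor\<close>

definition lap :: "'n \<Rightarrow> 'a^'n" where
  "lap j = (\<Sum>a\<in>UNIV. \<Sum>b\<in>UNIV. G a b *s cov2 a (\<lambda>a. cov a Rv) b j)"

lemma trace_cov2_Y: "(\<Sum>i\<in>UNIV. cov2 i Y j k $ i) = ip (lap j) (e k)"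
proof -
  have "ip (cov2 i Y j k) (e m) = ip (cov2 i (\<lambda>a. cov a Rv) m j) (e k)" for i m
    unfolding ip_cov2 by (simp add: ip_Y)
  then show ?thesis
    by (simp add: component_ip[of "cov2 _ _ _ _"] lap_def ip_linear)
qed

text \<open>The Ricci identity moves the divergence inside the derivative in direction
  \<open>k\<close>; its two curvature terms trace to the square of the Ricci tensor and to
  \<open>Z\<close>.\<close>

lemma trace_cov2_cov_Rv:
  "(\<Sum>i\<in>UNIV. cov2 i (\<lambda>j k. cov k Rv j) j k $ i)
    = pd (Some k) (dv j) - (\<Sum>q\<in>UNIV. Om (Some k) j q * dv q) + ip (Rv j) (Rv k) - Z j k"
proof -
  have "(\<Sum>i\<in>UNIV. cov2 i (\<lambda>j k. cov k Rv j) j k $ i)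
     = (\<Sum>i\<in>UNIV. cov2 k (\<lambda>a. cov a Rv) i j $ i) + (\<Sum>i\<in>UNIV. cur (Some i) (Some k) (Rv j) $ i)
       - (\<Sum>i\<in>UNIV. \<Sum>q\<in>UNIV. cur (Some i) (Some k) (e j) $ q * Rv q $ i)"
  proof -
    have "cov2 i (\<lambda>j k. cov k Rv j) j k = cov2 k (\<lambda>a. cov a Rv) i j
       + cur (Some i) (Some k) (Rv j) - (\<Sum>q\<in>UNIV. cur (Some i) (Some k) (e j) $ q *s Rv q)" for i
      unfolding cov2_flip[of i "\<lambda>a. cov a Rv"] using cov2_commutator[of i Rv k j] by (simp add: algebra_simps)
    then show ?thesis by (simp add: sum.distrib sum_subtractf)
  qed
  also have "(\<Sum>i\<in>UNIV. cur (Some i) (Some k) (Rv j) $ i) = ip (Rv k) (Rv j)"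
  proof -
    have "(\<Sum>i\<in>UNIV. cur (Some i) (Some k) (Rv j) $ i)
       = (\<Sum>i\<in>UNIV. \<Sum>q\<in>UNIV. Rv j $ q * cur (Some i) (Some k) (e q) $ i)"
      by (subst cur_expand) simp
    also have "\<dots> = (\<Sum>q\<in>UNIV. Rv j $ q * ric k q)"
      by (subst sum.swap) (simp add: ric_def sum_distrib_left)
    finally show ?thesis by (simp add: ip_Rv_right)
  qed
  also have "(\<Sum>i\<in>UNIV. \<Sum>q\<in>UNIV. cur (Some i) (Some k) (e j) $ q * Rv q $ i) = Z j k"
    by (subst Z_sym) (simp add: Z_def mult.commute)
  finally show ?thesis
    by (simp add: trace_cov2 ip_commute[of "Rv k"] flip: dv_def)
qed

end

text \<open>With the time coefficients prescribed by \<open>Om_time\<close>, the assumption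
  \<open>metric\<close> in direction \<open>None\<close> becomes the flow equation.\<close>

locale modified_flow = metric_connection pd g G Om h
  for pd :: "'n::finite option \<Rightarrow> 'a::comm_ring_1 \<Rightarrow> 'a" and g G Om and h :: 'a +
  fixes f :: 'a
  assumes Om_time: "nab None (e i) = - Rv i + nab (Some i) (grad f)"
begin

abbreviation V :: "'a^'n" where "V \<equiv> grad f"

definition S :: "'n \<Rightarrow> 'a^'n" where "S i = - Rv i + nab (Some i) V"

lemma nab_time_e: "nab None (e i) = S i"
  by (simp add: S_def Om_time)

lemma Om_S: "Om None i l = S i $ l"
  by (simp add: nab_e_component[symmetric] nab_time_e)

lemma ip_S_sym: "ip (S i) (e j) = ip (S j) (e i)"
  by (simp add: S_def ip_linear ip_Rv ric_sym[of i j] hess_sym[of i f j])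

lemma cov_S: "cov m S i = - cov m Rv i + cov m (\<lambda>i. nab (Some i) V) i"
  by (simp add: vec_eq_iff cov_def S_def nab_linear algebra_simps sum_subtractf sum.distrib)

text \<open>The Hessian part of \<open>S\<close> contributes a commutator on \<open>V\<close>, hence
  curvature; the connection terms in the two \<open>cov\<close> expressions cancel by torsion
  freeness.\<close>

lemma curvature_spatial_time:
  "nab (Some i) (S j) - nab (Some j) (S i)
    = - cov i Rv j + cov j Rv i + (\<Sum>p\<in>UNIV. V $ p *s cur (Some i) (Some j) (e p))"
  unfolding cur_expand[symmetric] by (simp add: S_def nab_linear cov_def torsion_free[of j i] cur_def)

text \<open>In Koszul's formula the Ricci part of \<open>S\<close> gives the first two terms and the
  Hessian part, through \<open>hess_commutator\<close>, the curvature term.\<close>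

lemma mixed_curvature:
  "cur (Some i) None (e k) = - Y i k + cov k Rv i + (\<Sum>p\<in>UNIV. V $ p *s cur (Some i) (Some p) (e k))"
proof (rule ip_eqI)
  fix l
  have "ip (cur (Some i) None (e k)) (e l) = ip (cov l S i) (e k) - ip (cov k S i) (e l)"
    by (rule mixed_curvature_koszul) (simp_all add: nab_time_e ip_S_sym fun_eq_iff)
  then show "ip (cur (Some i) None (e k)) (e l)
      = ip (- Y i k + cov k Rv i + (\<Sum>p\<in>UNIV. V $ p *s cur (Some i) (Some p) (e k))) (e l)"
    using hess_commutator[of l f i k]
    by (simp add: cov_S ip_linear ip_Y Rm_def algebra_simps)
qed

definition pot :: 'a where "pot = - (h * scal) + pd None f - h * ip V V"

text \<open>The mixed space-time derivative of \<open>f\<close> cancels, and half the gradient of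
  \<open>ip V V\<close> cancels the Hessian part of \<open>S\<close>; the Ricci part
  remains.\<close>

lemma grad_pot_minus: "grad pot - nab None V = - (h *s grad scal) - (\<Sum>p\<in>UNIV. V $ p *s Rv p)"
proof (rule ip_eqI)
  fix l
  have "h * (ip (nab (Some l) V) V + ip V (nab (Some l) V)) = (h + h) * ip V (nab (Some l) V)"
    by (simp only: ip_commute[of "nab (Some l) V"] distrib_left distrib_right)
  then have "pd (Some l) pot = - (h * pd (Some l) scal) + pd (Some l) (pd None f) - ip V (nab (Some l) V)"
    by (simp add: pot_def pd_diff pd_add pd_uminus pd_mult pd_ip half)
  moreover have "ip (nab None V) (e l) = pd (Some l) (pd None f) - ip V (S l)"
    using pd_ip[of None V "e l"] by (simp add: ip_grad nab_time_e pd_commute[of None])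
  moreover have "ip V (Rv l) = (\<Sum>p\<in>UNIV. V $ p * ric p l)"
    by (simp add: ip_commute[of V] ip_Rv_right ric_sym[of l])
  ultimately show "ip (grad pot - nab None V) (e l)
      = ip (- (h *s grad scal) - (\<Sum>p\<in>UNIV. V $ p *s Rv p)) (e l)"
    by (simp add: ip_linear ip_grad ip_Rv S_def)
qed

text \<open>Exchanging \<open>nab None\<close> and \<open>nab (Some i)\<close> on \<open>V\<close>
  produces the mixed curvature. Both forms of (E4) start here and differ in how
  \<open>nab None (Rv i)\<close> is evaluated.\<close>

lemma time_time_curvature:
  "nab (Some i) (grad pot) - nab None (S i)
    = nab None (Rv i) - h *s nab (Some i) (grad scal)
      - (\<Sum>p\<in>UNIV. nab (Some i) V $ p *s Rv p) - (\<Sum>p\<in>UNIV. V $ p *s cov i Rv p)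
      + (\<Sum>k\<in>UNIV. V $ k *s cur (Some i) None (e k))"
proof -
  have "nab (Some i) (\<Sum>p\<in>UNIV. V $ p *s Rv p)
      = (\<Sum>p\<in>UNIV. nab (Some i) V $ p *s Rv p) + (\<Sum>p\<in>UNIV. V $ p *s cov i Rv p)"
  proof -
    \<comment> \<open>Writing derivatives of the components of \<open>V\<close> through
      \<open>nab\<close> leaves this correction, which is the connection term in
      \<open>cov i Rv p\<close>.\<close>
    have "(\<Sum>p\<in>UNIV. (\<Sum>m\<in>UNIV. Om (Some i) m p * V $ m) *s Rv p)
       = (\<Sum>p\<in>UNIV. V $ p *s (\<Sum>q\<in>UNIV. Om (Some i) p q *s Rv q))"
      by (simp add: vec_eq_iff sum_distrib_left sum_distrib_right mult.commute mult.left_commute)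
        (intro allI, subst sum.swap, rule refl)
    then show ?thesis
      by (simp add: nab_linear pd_component cov_def vec_eq_iff algebra_simps sum.distrib sum_subtractf)
  qed
  moreover have "nab (Some i) (grad pot - nab None V)
      = - (h *s nab (Some i) (grad scal)) - nab (Some i) (\<Sum>p\<in>UNIV. V $ p *s Rv p)"
    by (simp add: grad_pot_minus nab_diff nab_uminus nab_smult)
  moreover have "nab (Some i) (grad pot) - nab None (S i)
      = nab (Some i) (grad pot - nab None V) + nab None (Rv i) + cur (Some i) None V"
    by (simp add: S_def nab_add nab_diff nab_uminus cur_def)
  ultimately show ?thesis
    by (simp add: cur_expand[of _ _ V])
qed

section \<open>Evolution of the Ricci tensor\<close>

definition K :: "'n \<Rightarrow> 'n \<Rightarrow> 'a^'n" where "K j k = cur (Some j) None (e k)"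

definition N :: "'n \<Rightarrow> 'n \<Rightarrow> 'a^'n" where
  "N j k = (\<Sum>p\<in>UNIV. V $ p *s cur (Some j) (Some p) (e k))"

text \<open>The Jacobi identity for one time and two space derivatives. Connection terms in the
  first index of \<open>K\<close> cancel in the difference; those in the second account for the
  derivative of \<open>e k\<close>.\<close>

lemma time_jacobi:
  "nab None (cur (Some i) (Some j) (e k)) = cur (Some i) (Some j) (S k) - cov2 i K j k + cov2 j K i k"
proof -
  have "(\<Sum>q\<in>UNIV. Om (Some i) k q *s K j q) = cur (Some j) None (nab (Some i) (e k))" for i j
    by (simp add: K_def nab_e cur_sum cur_smult)
  then show ?thesis
    by (simp add: cov2_def torsion_free[of j i]) (simp add: K_def cur_def nab_linear nab_time_e)
qed

text \<open>The product rule for \<open>V\<close> contracted with curvature; the connection terms in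
  the contracted index \<open>p\<close> cancel between the two factors.\<close>

lemma cov2_N:
  "cov2 i N j k = (\<Sum>p\<in>UNIV. nab (Some i) V $ p *s cur (Some j) (Some p) (e k)) + (\<Sum>p\<in>UNIV. V $ p *s B i j p k)"
proof -
  have "(\<Sum>p\<in>UNIV. (\<Sum>m\<in>UNIV. Om (Some i) m p * V $ m) *s cur (Some j) (Some p) (e k))
     = (\<Sum>p\<in>UNIV. V $ p *s (\<Sum>q\<in>UNIV. Om (Some i) p q *s cur (Some j) (Some q) (e k)))"
    by (simp add: vec_eq_iff sum_distrib_left sum_distrib_right mult.commute mult.left_commute)
      (intro allI, subst sum.swap, rule refl)
  moreover have "(\<Sum>q\<in>UNIV. Om (Some i) j q *s N q k)
     = (\<Sum>p\<in>UNIV. V $ p *s (\<Sum>q\<in>UNIV. Om (Some i) j q *s cur (Some q) (Some p) (e k)))"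
    by (simp add: N_def vec_eq_iff sum_distrib_left mult.commute mult.left_commute)
      (intro allI, subst sum.swap, rule refl)
  moreover have "(\<Sum>q\<in>UNIV. Om (Some i) k q *s N j q)
     = (\<Sum>p\<in>UNIV. V $ p *s cur (Some j) (Some p) (nab (Some i) (e k)))"
    by (simp add: N_def nab_e cur_sum cur_smult vec_eq_iff sum_distrib_left mult.commute mult.left_commute)
      (intro allI, subst sum.swap, rule refl)
  moreover have "nab (Some i) (N j k) = (\<Sum>p\<in>UNIV. nab (Some i) V $ p *s cur (Some j) (Some p) (e k))
     - (\<Sum>p\<in>UNIV. (\<Sum>m\<in>UNIV. Om (Some i) m p * V $ m) *s cur (Some j) (Some p) (e k))
     + (\<Sum>p\<in>UNIV. V $ p *s nab (Some i) (cur (Some j) (Some p) (e k)))"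
    by (simp add: N_def nab_linear pd_component vec_eq_iff algebra_simps sum.distrib sum_subtractf)
  moreover have "(\<Sum>p\<in>UNIV. V $ p *s B i j p k) = (\<Sum>p\<in>UNIV. V $ p *s nab (Some i) (cur (Some j) (Some p) (e k)))
     - (\<Sum>p\<in>UNIV. V $ p *s cur (Some j) (Some p) (nab (Some i) (e k)))
     - (\<Sum>p\<in>UNIV. V $ p *s (\<Sum>q\<in>UNIV. Om (Some i) j q *s cur (Some q) (Some p) (e k)))
     - (\<Sum>p\<in>UNIV. V $ p *s (\<Sum>q\<in>UNIV. Om (Some i) p q *s cur (Some j) (Some q) (e k)))"
    by (simp add: B_def vector_ssub_ldistrib sum_subtractf)
  ultimately show ?thesis
    by (simp add: cov2_def)
qed

text \<open>The divergence of \<open>Y\<close> is the Laplacian, and commuting derivatives in the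
  other Ricci term gives \<open>Z\<close> and the Ricci square. The remaining derivatives of
  \<open>dv\<close> cancel.\<close>

lemma trace_K: "- (\<Sum>i\<in>UNIV. cov2 i K j k $ i) + (\<Sum>i\<in>UNIV. cov2 j K i k $ i)
  = ip (lap j) (e k) + Z j k - ip (Rv j) (Rv k)
    + (- (\<Sum>i\<in>UNIV. cov2 i N j k $ i) + (\<Sum>i\<in>UNIV. cov2 j N i k $ i))"
proof -
  let ?C = "\<lambda>j k. cov k Rv j"
  have K: "K = (\<lambda>j k. (?C j k - Y j k) + N j k)"
    by (simp add: fun_eq_iff K_def N_def mixed_curvature)
  have split: "cov2 b K a i = cov2 b ?C a i - cov2 b Y a i + cov2 b N a i" for a b i
    unfolding K cov2_add cov2_diff ..
  \<comment> \<open>Twice \<open>dv\<close> is the gradient of \<open>scal\<close>, so its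
    derivative is symmetric.\<close>
  have "pd (Some j) (dv k) = pd (Some k) (dv j)"
  proof -
    have "pd (Some j) (dv k) - pd (Some k) (dv j) + (pd (Some j) (dv k) - pd (Some k) (dv j)) = 0"
      using pd_commute[of "Some j" "Some k" scal]
      unfolding contracted_bianchi pd_add by (simp add: algebra_simps)
    from no_2_torsion[OF this] show ?thesis by simp
  qed
  then have "(\<Sum>i\<in>UNIV. cov2 j ?C i k $ i) - (\<Sum>i\<in>UNIV. cov2 j Y i k $ i)
      = pd (Some k) (dv j) - (\<Sum>q\<in>UNIV. Om (Some k) j q * dv q)"
    unfolding trace_cov2 trace_Y trace_cov scal_def[symmetric] contracted_bianchi pd_add
      distrib_left sum.distrib torsion_free[of k j]
    by simp
  then show ?thesis
    by (simp add: split sum.distrib sum_subtractf trace_cov2_cov_Rv trace_cov2_Y algebra_simps)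
qed

text \<open>The second Bianchi identity combines the two derivatives of curvature into a single one
  along \<open>V\<close>, whose trace is a derivative of the Ricci tensor.\<close>

lemma trace_N: "- (\<Sum>i\<in>UNIV. cov2 i N j k $ i) + (\<Sum>i\<in>UNIV. cov2 j N i k $ i)
  = (\<Sum>i\<in>UNIV. \<Sum>p\<in>UNIV. nab (Some i) V $ p * cur (Some p) (Some j) (e k) $ i)
    + (\<Sum>p\<in>UNIV. nab (Some j) V $ p * ric p k)
    + (\<Sum>p\<in>UNIV. V $ p * ip (cov p Rv j) (e k))"
proof -
  have "- B i j p k + B j i p k = B p i j k" for i p
    using bianchi2[of p i j k] B_antisym[of j i p k]
    by (simp add: algebra_simps neg_eq_iff_add_eq_0)
  then have "- cov2 i N j k + cov2 j N i k
    = (\<Sum>p\<in>UNIV. nab (Some i) V $ p *s cur (Some p) (Some j) (e k))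
     + (\<Sum>p\<in>UNIV. nab (Some j) V $ p *s cur (Some i) (Some p) (e k))
     + (\<Sum>p\<in>UNIV. V $ p *s B p i j k)" for i
    by (simp add: cov2_N cur_antisym[of _ "Some j"] vec_eq_iff sum_negf algebra_simps
        flip: sum.distrib sum_subtractf)
  then have "(- cov2 i N j k + cov2 j N i k) $ i
    = (\<Sum>p\<in>UNIV. nab (Some i) V $ p * cur (Some p) (Some j) (e k) $ i)
     + (\<Sum>p\<in>UNIV. nab (Some j) V $ p * cur (Some i) (Some p) (e k) $ i)
     + (\<Sum>p\<in>UNIV. V $ p * B p i j k $ i)" for i
    by simp
  then have "(\<Sum>i\<in>UNIV. (- cov2 i N j k + cov2 j N i k) $ i)
    = (\<Sum>i\<in>UNIV. \<Sum>p\<in>UNIV. nab (Some i) V $ p * cur (Some p) (Some j) (e k) $ i)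
     + (\<Sum>i\<in>UNIV. \<Sum>p\<in>UNIV. nab (Some j) V $ p * cur (Some i) (Some p) (e k) $ i)
     + (\<Sum>i\<in>UNIV. \<Sum>p\<in>UNIV. V $ p * B p i j k $ i)"
    by (simp add: sum.distrib)
  also have "(\<Sum>i\<in>UNIV. \<Sum>p\<in>UNIV. nab (Some j) V $ p * cur (Some i) (Some p) (e k) $ i)
     = (\<Sum>p\<in>UNIV. nab (Some j) V $ p * ric p k)"
    by (subst sum.swap) (simp add: ric_def sum_distrib_left)
  also have "(\<Sum>i\<in>UNIV. \<Sum>p\<in>UNIV. V $ p * B p i j k $ i) = (\<Sum>p\<in>UNIV. V $ p * ip (cov p Rv j) (e k))"
    by (subst sum.swap) (simp add: sum_distrib_left[symmetric] trace_B)
  finally show ?thesis by (simp add: sum_subtractf)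
qed

text \<open>The trace of \<open>time_jacobi\<close>. Differentiating the trace also involves
  \<open>S\<close> on the upper index: its Ricci part supplies the second \<open>Z\<close>, its
  Hessian part cancels a term of \<open>trace_N\<close>.\<close>

lemma ric_evolution:
  "pd None (ric j k) = ip (Rv j) (S k) + ip (lap j) (e k) + Z j k + Z j k - ip (Rv j) (Rv k)
    + (\<Sum>p\<in>UNIV. nab (Some j) V $ p * ric p k) + (\<Sum>p\<in>UNIV. V $ p * ip (cov p Rv j) (e k))"
proof -
  let ?s = "\<lambda>i. cur (Some i) (Some j) (e k)"
  have "pd None (ric j k) = (\<Sum>i\<in>UNIV. nab None (?s i) $ i) - (\<Sum>i\<in>UNIV. \<Sum>m\<in>UNIV. S m $ i * ?s i $ m)"
    by (simp add: ric_def pd_sum pd_component Om_S sum_subtractf)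
  also have "(\<Sum>i\<in>UNIV. nab None (?s i) $ i) = (\<Sum>i\<in>UNIV. cur (Some i) (Some j) (S k) $ i)
      + (- (\<Sum>i\<in>UNIV. cov2 i K j k $ i) + (\<Sum>i\<in>UNIV. cov2 j K i k $ i))"
    by (simp add: time_jacobi sum.distrib sum_subtractf)
  also have "(\<Sum>i\<in>UNIV. cur (Some i) (Some j) (S k) $ i) = ip (Rv j) (S k)"
  proof -
    have "(\<Sum>i\<in>UNIV. cur (Some i) (Some j) (S k) $ i)
       = (\<Sum>i\<in>UNIV. \<Sum>q\<in>UNIV. S k $ q * cur (Some i) (Some j) (e q) $ i)"
      by (subst cur_expand) simp
    also have "\<dots> = (\<Sum>q\<in>UNIV. S k $ q * ric j q)"
      by (subst sum.swap) (simp add: ric_def sum_distrib_left)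
    finally show ?thesis by (simp add: ip_Rv_right)
  qed
  also have "(\<Sum>i\<in>UNIV. \<Sum>m\<in>UNIV. S m $ i * ?s i $ m) = - Z j k
     + (\<Sum>i\<in>UNIV. \<Sum>p\<in>UNIV. nab (Some i) V $ p * cur (Some p) (Some j) (e k) $ i)"
  proof -
    have "(\<Sum>i\<in>UNIV. \<Sum>m\<in>UNIV. S m $ i * ?s i $ m) = - Z j k
     + (\<Sum>p\<in>UNIV. \<Sum>i\<in>UNIV. nab (Some i) V $ p * cur (Some p) (Some j) (e k) $ i)"
      by (simp add: S_def Z_def algebra_simps sum.distrib sum_subtractf sum_negf)
    then show ?thesis by (subst sum.swap)
  qed
  finally show ?thesis
    unfolding trace_K trace_N by simp
qed

text \<open>Since \<open>nab None\<close> preserves the metric, raising the index removes the term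
  \<open>ip (Rv j) (S k)\<close> from \<open>ric_evolution\<close>.\<close>

lemma Rv_evolution:
  "nab None (Rv j) = (\<Sum>p\<in>UNIV. V $ p *s cov p Rv j) + (\<Sum>p\<in>UNIV. nab (Some j) V $ p *s Rv p)
    + lap j + (\<chi> l. \<Sum>m\<in>UNIV. G l m * (2 * Z j m))
    - (\<Sum>m\<in>UNIV. Rv j $ m *s Rv m)"
proof (rule ip_eqI)
  fix k
  have "ip (nab None (Rv j)) (e k) = pd None (ric j k) - ip (Rv j) (S k)"
    using pd_ip[of None "Rv j" "e k"] by (simp add: ip_Rv nab_time_e)
  moreover have "(\<Sum>m\<in>UNIV. Rv j $ m * ric m k) = ip (Rv j) (Rv k)"
    by (subst ip_commute) (simp only: ip_Rv_right ric_sym[of k])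
  ultimately show "ip (nab None (Rv j)) (e k)
    = ip ((\<Sum>p\<in>UNIV. V $ p *s cov p Rv j) + (\<Sum>p\<in>UNIV. nab (Some j) V $ p *s Rv p)
    + lap j + (\<chi> l. \<Sum>m\<in>UNIV. G l m * (2 * Z j m))
    - (\<Sum>m\<in>UNIV. Rv j $ m *s Rv m)) (e k)"
    by (simp add: ric_evolution ip_add_left ip_diff_left ip_sum_left ip_smult_left ip_raise ip_Rv)
qed

end

section \<open>Transfer to the modified Ricci flow\<close>

lemma sum_option: "(\<Sum>m\<in>UNIV. F m) = F None + (\<Sum>m\<in>UNIV. F (Some m))"
  for F :: "'n::finite option \<Rightarrow> 'b::comm_monoid_add"
  by (simp add: UNIV_option_conv sum.reindex)

lemma tdpart_shift:
  "tdpart a (\<lambda>z. F (fst z, snd z + \<tau>)) z = tdpart a F (fst z, snd z + \<tau>)"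
proof -
  have "(fst (z + s *\<^sub>R d), snd (z + s *\<^sub>R d) + \<tau>) = (fst z, snd z + \<tau>) + s *\<^sub>R d"
    for s and d :: "(real^'a) \<times> real"
    by (simp add: prod_eq_iff)
  then show ?thesis by (simp add: tdpart_eq_deriv)
qed

text \<open>Time translation commutes with partial derivatives, so it suffices to treat
  \<open>\<tau> = 0\<close> at the shifted point.\<close>

lemma tRiem_shift: "tRiem g f \<tau> a b c d (x, t) = tRiem g f 0 a b c d (x, t + \<tau>)"
proof -
  have "tChr g f \<tau> a b c = (\<lambda>z. tChr g f 0 a b c (fst z, snd z + \<tau>))" for a b c
    by (simp add: fun_eq_iff tChr_def)
  then show ?thesis
    unfolding tRiem_def by (simp add: tdpart_shift)
qed

lemma dpart_eq: "dpart i = tdpart (Some i)" and dtime_eq: "dtime = tdpart None"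
  by (simp_all add: fun_eq_iff tdpart_def)

lemma ginv_g:
  assumes "det (\<chi> a b. g a b z) \<noteq> 0"
  shows "(\<Sum>k\<in>UNIV. ginv g i k z * g k j z) = (if i = j then 1 else 0)"
proof -
  let ?A = "\<chi> a b. g a b z"
  have "(matrix_inv ?A ** ?A) $ i $ j = (mat 1 :: real^'a^'a) $ i $ j"
    using assms by (simp add: matrix_inv_inverse)
  then show ?thesis
    by (simp add: matrix_matrix_mult_def ginv_def mat_def)
qed

lemma ginv_sym:
  assumes "det (\<chi> a b. g a b z) \<noteq> 0" and sym: "\<And>i j. g i j z = g j i z"
  shows "ginv g i j z = ginv g j i z"
proof -
  let ?A = "\<chi> a b. g a b z" and ?B = "matrix_inv (\<chi> a b. g a b z)"
  have AB: "?A ** ?B = mat 1"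
    using assms(1) by (rule matrix_inv_inverse)
  have "transpose ?A = ?A"
    by (simp add: vec_eq_iff transpose_def sym)
  then have "transpose ?B ** ?A = transpose (?A ** ?B)"
    by (simp add: matrix_transpose_mul)
  then have BA: "transpose ?B ** ?A = mat 1"
    by (simp add: AB)
  have "transpose ?B = transpose ?B ** (?A ** ?B)"
    by (simp add: AB)
  also have "\<dots> = ?B"
    unfolding matrix_mul_assoc BA by simp
  finally have "transpose ?B $ i $ j = ?B $ i $ j" by simp
  then show ?thesis
    by (simp add: ginv_def transpose_def)
qed

definition value_jet :: "'k jet \<Rightarrow> real" where "value_jet j = coeff_jet j []"

lemma value_jet_hom:
  "value_jet (j + k) = value_jet j + value_jet k"
  "value_jet (j - k) = value_jet j - value_jet k"
  "value_jet (- j) = - value_jet j"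
  "value_jet (j * k) = value_jet j * value_jet k"
  "value_jet 0 = 0" "value_jet 1 = 1" "value_jet 2 = 2"
proof -
  show add: "value_jet (j + k) = value_jet j + value_jet k" for j k :: "'k jet"
    by (simp add: value_jet_def plus_jet.rep_eq)
  show one: "value_jet 1 = 1" by (simp add: value_jet_def one_jet.rep_eq)
  show "value_jet 2 = 2" using add[of 1 1] by (simp add: one)
qed (simp_all add: value_jet_def minus_jet.rep_eq uminus_jet.rep_eq times_jet.rep_eq zero_jet.rep_eq)

lemma value_jet_sum: "value_jet (\<Sum>i\<in>I. F i) = (\<Sum>i\<in>I. value_jet (F i))"
  by (induction I rule: infinite_finite_induct) (auto simp: value_jet_hom)

text \<open>Invertibility holds on all of \<open>W\<close>, which makes the inverse metric smooth
  there; symmetry and the flow equation are known on \<open>D\<close> only.\<close>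

locale metric_region = flow_region_point W U T z
  for W :: "((real^'n::finite) \<times> real) set" and U T z +
  fixes g :: "'n metric" and f :: "(real^'n) \<times> real \<Rightarrow> real"
  assumes smooth_g: "smooth (g i j)" and smooth_f: "smooth f"
    and det: "y \<in> W \<Longrightarrow> det (\<chi> a b. g a b y) \<noteq> 0"
    and g_sym': "y \<in> D \<Longrightarrow> g i j y = g j i y"
    and flow: "y \<in> D \<Longrightarrow> dtime (g i j) y = - 2 * Ric g i j y + 2 * Hess g f i j y"
begin

section \<open>Smoothness of the tensors\<close>

lemmas smooth_ops = Cinf_on_const Cinf_on_add[OF open_W] Cinf_on_diff[OF open_W]
  Cinf_on_mult[OF open_W] Cinf_on_uminus[OF open_W] Cinf_on_sum[OF open_W] Cinf_on_tdpart[OF open_W]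
  smooth_g smooth_f

lemma smooth_half: "smooth F \<Longrightarrow> smooth (\<lambda>y. F y / 2)"
  by (intro Cinf_on_divide open_W Cinf_on_const) auto

lemma smooth_ginv: "smooth (ginv g i j)"
  by (rule Cinf_on_ginv[OF open_W smooth_g det])

lemma smooth_Chr: "smooth (Chr g i j k)"
  unfolding Chr_def[abs_def] dpart_eq by (intro smooth_ops smooth_ginv)

lemma smooth_Riem: "smooth (Riem g i j k l)"
  unfolding Riem_def[abs_def] dpart_eq by (intro smooth_ops smooth_Chr)

lemma smooth_Ric: "smooth (Ric g i j)"
  unfolding Ric_def[abs_def] by (intro smooth_ops smooth_Riem)

lemma smooth_Scal: "smooth (Scal g)"
  unfolding Scal_def[abs_def] by (intro smooth_ops smooth_Ric smooth_ginv)

lemma smooth_RicM: "smooth (RicM g i l)"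
  unfolding RicM_def[abs_def] by (intro smooth_ops smooth_Ric smooth_ginv)

lemma smooth_Hess: "smooth F \<Longrightarrow> smooth (Hess g F i j)"
  unfolding Hess_def[abs_def] dpart_eq by (intro smooth_ops smooth_Chr)

lemma smooth_gradU: "smooth F \<Longrightarrow> smooth (gradU g F k)"
  unfolding gradU_def[abs_def] dpart_eq by (intro smooth_ops smooth_ginv)

lemma smooth_normsq: "smooth F \<Longrightarrow> smooth (normsq g F)"
  unfolding normsq_def[abs_def] dpart_eq by (intro smooth_ops smooth_ginv)

lemma smooth_HessU: "smooth F \<Longrightarrow> smooth (HessU g F i k)"
  unfolding HessU_def vecCov_def[abs_def] dpart_eq by (intro smooth_ops smooth_Chr smooth_gradU)

lemma smooth_cov02: "(\<And>i k. smooth (S i k)) \<Longrightarrow> smooth (cov02 g S m i k)"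
  unfolding cov02_def[abs_def] dpart_eq by (intro smooth_ops smooth_Chr)

lemma smooth_cov11: "(\<And>i k. smooth (S i k)) \<Longrightarrow> smooth (cov11 g S m i k)"
  unfolding cov11_def[abs_def] dpart_eq by (intro smooth_ops smooth_Chr)

lemma smooth_cov12: "(\<And>a i k. smooth (S a i k)) \<Longrightarrow> smooth (cov12 g S m a i k)"
  unfolding cov12_def[abs_def] dpart_eq by (intro smooth_ops smooth_Chr)

lemma smooth_Lap11: "(\<And>i k. smooth (S i k)) \<Longrightarrow> smooth (Lap11 g S i k)"
  unfolding Lap11_def[abs_def] by (intro smooth_ops smooth_ginv smooth_cov12 smooth_cov11)

lemma smooth_Pt: "smooth (Pt g i j k)"
  unfolding Pt_def[abs_def] by (intro smooth_ops smooth_cov02 smooth_Ric)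

lemmas smooth_tensors = smooth_half smooth_ginv smooth_Chr smooth_Riem smooth_Ric smooth_Scal smooth_RicM
  smooth_Hess smooth_gradU smooth_normsq smooth_HessU smooth_cov02 smooth_cov11 smooth_cov12
  smooth_Lap11 smooth_Pt

lemmas smooth_all = smooth_ops smooth_tensors

lemmas J_ops = J_add J_diff J_mult J_uminus J_sum J_tdpart J_0 J_1

definition Jh :: "'n option jet" where "Jh = J (\<lambda>y. 1 / 2)"
abbreviation Jg :: "'n \<Rightarrow> 'n \<Rightarrow> 'n option jet" where "Jg i j \<equiv> J (g i j)"
abbreviation JG :: "'n \<Rightarrow> 'n \<Rightarrow> 'n option jet" where "JG i j \<equiv> J (ginv g i j)"

definition JOm :: "'n option \<Rightarrow> 'n \<Rightarrow> 'n \<Rightarrow> 'n option jet" where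
  "JOm a i l = (case a of Some k \<Rightarrow> J (Chr g k i l) | None \<Rightarrow> - J (RicM g i l) + J (HessU g f i l))"

lemma Jh: "Jh + Jh = 1"
  using J_add[OF Cinf_on_const Cinf_on_const, of "1 / 2" "1 / 2"] by (simp add: J_1 Jh_def)

lemma J_half: "smooth F \<Longrightarrow> J (\<lambda>y. F y / 2) = Jh * J F"
  using J_mult[OF Cinf_on_const, of F "1 / 2"] by (simp add: Jh_def)

lemma J_2: "J (\<lambda>y. 2) = 2"
  using J_add[OF Cinf_on_const Cinf_on_const, of 1 1] by (simp add: J_1)

lemma Jg_sym: "Jg i j = Jg j i"
  by (rule J_cong[OF smooth_g smooth_g g_sym'])

lemma JG_sym: "JG i j = JG j i"
  by (rule J_cong[OF smooth_ginv smooth_ginv]) (rule ginv_sym; simp add: det D_W g_sym')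

lemma JG_g: "(\<Sum>k\<in>UNIV. JG i k * Jg k j) = (if i = j then 1 else 0)"
proof -
  have "(\<Sum>k\<in>UNIV. JG i k * Jg k j) = J (\<lambda>y. \<Sum>k\<in>UNIV. ginv g i k y * g k j y)"
    by (simp add: J_ops smooth_all)
  also have "\<dots> = J (\<lambda>y. if i = j then 1 else 0)"
    by (rule J_cong) (auto intro!: smooth_ops smooth_ginv simp: ginv_g det D_W)
  finally show ?thesis by (simp add: J_0 J_1)
qed

lemma Jg_lower: "(\<Sum>m\<in>UNIV. (\<Sum>l\<in>UNIV. JG m l * w l) * Jg m j) = w j"
proof -
  have "(\<Sum>m\<in>UNIV. (\<Sum>l\<in>UNIV. JG m l * w l) * Jg m j) = (\<Sum>m\<in>UNIV. \<Sum>l\<in>UNIV. (JG l m * Jg m j) * w l)"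
    by (simp add: sum_distrib_left sum_distrib_right JG_sym mult.commute mult.left_commute)
  also have "\<dots> = (\<Sum>l\<in>UNIV. (\<Sum>m\<in>UNIV. JG l m * Jg m j) * w l)"
    by (subst sum.swap) (simp add: sum_distrib_right)
  also have "\<dots> = w j"
    by (simp add: JG_g if_distrib[of "\<lambda>x. x * _"] cong: if_cong)
  finally show ?thesis .
qed

lemma J_Chr: "J (Chr g i j k) = Jh * (\<Sum>l\<in>UNIV. JG k l *
    (jet_deriv (Some i) (Jg j l) + jet_deriv (Some j) (Jg i l) - jet_deriv (Some l) (Jg i j)))"
  unfolding Chr_def[abs_def] dpart_eq by (simp add: J_ops J_half smooth_all)

lemma Chr_lower: "(\<Sum>m\<in>UNIV. J (Chr g k i m) * Jg m j)
    = Jh * (jet_deriv (Some k) (Jg i j) + jet_deriv (Some i) (Jg k j) - jet_deriv (Some j) (Jg k i))"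
  using Jg_lower[of "\<lambda>l. jet_deriv (Some k) (Jg i l) + jet_deriv (Some i) (Jg k l) - jet_deriv (Some l) (Jg k i)" j]
  by (simp only: J_Chr mult.assoc sum_distrib_left[symmetric])

lemma Chr_metric: "jet_deriv (Some k) (Jg i j)
    = (\<Sum>m\<in>UNIV. J (Chr g k i m) * Jg m j) + (\<Sum>m\<in>UNIV. J (Chr g k j m) * Jg i m)"
proof -
  have "(Jh + Jh) * jet_deriv (Some k) (Jg i j)
      = (\<Sum>m\<in>UNIV. J (Chr g k i m) * Jg m j) + (\<Sum>m\<in>UNIV. J (Chr g k j m) * Jg m i)"
    unfolding Chr_lower by (simp add: Jg_sym[of j i] algebra_simps)
  then show ?thesis by (simp add: Jh Jg_sym[of i])
qed

text \<open>\<open>HessU\<close> differentiates the gradient vector and \<open>Hess\<close> the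
  differential; metric compatibility of the Christoffel symbols identifies the two after lowering an
  index.\<close>

lemma Hess_lower:
  assumes F: "smooth F"
  shows "(\<Sum>m\<in>UNIV. J (HessU g F i m) * Jg m j) = J (Hess g F i j)"
proof -
  let ?v = "\<lambda>m. J (gradU g F m)"
  have low: "(\<Sum>m\<in>UNIV. ?v m * Jg m j) = jet_deriv (Some j) (J F)" for j
    using Jg_lower[of "\<lambda>l. jet_deriv (Some l) (J F)" j]
    by (simp add: gradU_def[abs_def] dpart_eq J_ops smooth_all F)
  have HU: "J (HessU g F i m) = jet_deriv (Some i) (?v m) + (\<Sum>p\<in>UNIV. J (Chr g i p m) * ?v p)" for m
    by (simp add: HessU_def vecCov_def[abs_def] dpart_eq J_ops smooth_all F)
  have deriv_sum: "jet_deriv a (\<Sum>i\<in>I. w i) = (\<Sum>i\<in>I. jet_deriv a (w i))" for a w and I :: "'n set"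
    using jet_deriv_add[of a 0 0] by (induction I rule: infinite_finite_induct) (auto simp: jet_deriv_add)
  have "jet_deriv (Some i) (jet_deriv (Some j) (J F))
      = (\<Sum>m\<in>UNIV. jet_deriv (Some i) (?v m) * Jg m j) + (\<Sum>m\<in>UNIV. ?v m * jet_deriv (Some i) (Jg m j))"
    by (simp add: low[symmetric] deriv_sum jet_deriv_mult sum.distrib)
  also have "(\<Sum>m\<in>UNIV. ?v m * jet_deriv (Some i) (Jg m j))
      = (\<Sum>m\<in>UNIV. (\<Sum>p\<in>UNIV. J (Chr g i p m) * ?v p) * Jg m j)
        + (\<Sum>q\<in>UNIV. J (Chr g i j q) * (\<Sum>m\<in>UNIV. ?v m * Jg m q))"
  proof -
    have "(\<Sum>m\<in>UNIV. ?v m * jet_deriv (Some i) (Jg m j))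
      = (\<Sum>m\<in>UNIV. \<Sum>q\<in>UNIV. ?v m * (J (Chr g i m q) * Jg q j))
        + (\<Sum>m\<in>UNIV. \<Sum>q\<in>UNIV. ?v m * (J (Chr g i j q) * Jg m q))"
      by (simp only: Chr_metric distrib_left sum_distrib_left sum.distrib)
    also have "(\<Sum>m\<in>UNIV. \<Sum>q\<in>UNIV. ?v m * (J (Chr g i m q) * Jg q j))
       = (\<Sum>m\<in>UNIV. (\<Sum>p\<in>UNIV. J (Chr g i p m) * ?v p) * Jg m j)"
      by (subst sum.swap) (simp add: sum_distrib_left mult.commute mult.left_commute)
    also have "(\<Sum>m\<in>UNIV. \<Sum>q\<in>UNIV. ?v m * (J (Chr g i j q) * Jg m q))
       = (\<Sum>q\<in>UNIV. J (Chr g i j q) * (\<Sum>m\<in>UNIV. ?v m * Jg m q))"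
      by (subst sum.swap) (simp add: sum_distrib_left mult.commute mult.left_commute)
    finally show ?thesis .
  qed
  finally have "(\<Sum>m\<in>UNIV. J (HessU g F i m) * Jg m j)
      = jet_deriv (Some i) (jet_deriv (Some j) (J F)) - (\<Sum>q\<in>UNIV. J (Chr g i j q) * jet_deriv (Some q) (J F))"
    by (simp add: HU low distrib_right sum.distrib)
  then show ?thesis
    by (simp add: Hess_def[abs_def] dpart_eq J_ops smooth_all F)
qed

lemma Ric_lower: "(\<Sum>m\<in>UNIV. J (RicM g i m) * Jg m j) = J (Ric g i j)"
  using Jg_lower[of "\<lambda>l. J (Ric g i l)" j]
  by (simp add: RicM_def[abs_def] J_ops smooth_all)

lemma flow_metric: "jet_deriv None (Jg i j)
    = (\<Sum>m\<in>UNIV. JOm None i m * Jg m j) + (\<Sum>m\<in>UNIV. JOm None j m * Jg i m)"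
proof -
  have d: "jet_deriv None (Jg i j) = - 2 * J (Ric g i j) + 2 * J (Hess g f i j)" for i j
  proof -
    have "J (dtime (g i j)) = J (\<lambda>y. - 2 * Ric g i j y + 2 * Hess g f i j y)"
      by (rule J_cong) (auto intro!: smooth_all simp: dtime_eq flow[unfolded dtime_eq])
    also have "\<dots> = - 2 * J (Ric g i j) + 2 * J (Hess g f i j)"
      using J_uminus[OF Cinf_on_const, of 2] by (simp add: J_ops smooth_all J_2)
    finally show ?thesis by (simp add: dtime_eq J_tdpart smooth_g)
  qed
  let ?s = "\<lambda>i j. - J (Ric g i j) + J (Hess g f i j)"
  have s: "(\<Sum>m\<in>UNIV. JOm None i m * Jg m j) = ?s i j" for i j
    using Ric_lower[of i j] Hess_lower[OF smooth_f, of i j]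
    by (simp add: JOm_def distrib_right sum.distrib sum_negf sum_subtractf algebra_simps)
  \<comment> \<open>Symmetry of \<open>- Ric + Hess\<close> is read off from the flow equation and
    the symmetry of \<open>g\<close>: \<open>ric_sym\<close> belongs to the locale whose assumptions
    are being established here.\<close>
  have "?s j i - ?s i j + (?s j i - ?s i j) = 0"
    using d[of i j] d[of j i] Jg_sym[of i j] by (simp add: algebra_simps)
  then have "(Jh + Jh) * (?s j i - ?s i j) = 0"
    by (simp only: distrib_right distrib_left[symmetric] mult_zero_right)
  then have sym: "?s j i = ?s i j" by (simp only: Jh mult_1 right_minus_eq)
  have "jet_deriv None (Jg i j) = ?s i j + ?s j i"
    unfolding sym by (simp add: d algebra_simps)
  also have "\<dots> = (\<Sum>m\<in>UNIV. JOm None i m * Jg m j) + (\<Sum>m\<in>UNIV. JOm None j m * Jg m i)"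
    by (simp only: s)
  finally show ?thesis by (simp only: Jg_sym[of _ i])
qed

sublocale mc: metric_connection jet_deriv "\<lambda>i j. Jg i j" "\<lambda>i j. JG i j" JOm Jh
proof
  show "JOm (Some i) j k = JOm (Some j) i k" for i j k
    by (simp add: JOm_def J_Chr Jg_sym[of j i] add.commute)
  show "jet_deriv a (Jg i j) = (\<Sum>m\<in>UNIV. JOm a i m * Jg m j) + (\<Sum>m\<in>UNIV. JOm a j m * Jg i m)" for a i j
  proof (cases a)
    case None
    then show ?thesis using flow_metric by simp
  next
    case (Some k)
    then show ?thesis using Chr_metric[of k i j] by (simp add: JOm_def)
  qed
qed (rule jet_deriv_add jet_deriv_mult jet_deriv_commute Jh Jg_sym JG_sym JG_g)+

section \<open>The geometric tensors as jets\<close>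

lemma J_Riem: "J (Riem g i j k l) = mc.cur (Some i) (Some j) (mc.e k) $ l"
  by (simp add: Riem_def[abs_def] dpart_eq J_ops smooth_all mc.cur_component JOm_def)

lemma J_Ric: "J (Ric g j k) = mc.ric j k"
  by (simp add: Ric_def[abs_def] J_ops smooth_all J_Riem mc.ric_def)

lemma J_RicM: "J (RicM g i l) = mc.Rv i $ l"
  by (simp add: RicM_def[abs_def] J_ops smooth_all J_Ric mc.Rv_def)

lemma J_Scal: "J (Scal g) = mc.scal"
  by (simp add: Scal_def[abs_def] J_ops smooth_all J_Ric mc.scal_def mc.Rv_def)

lemma J_gradU: "smooth F \<Longrightarrow> J (gradU g F k) = mc.grad (J F) $ k"
  by (simp add: gradU_def[abs_def] dpart_eq J_ops smooth_all mc.grad_def)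

lemma J_HessU: "smooth F \<Longrightarrow> J (HessU g F i k) = mc.nab (Some i) (mc.grad (J F)) $ k"
  by (simp add: HessU_def vecCov_def[abs_def] dpart_eq J_ops smooth_all J_gradU mc.nab_def JOm_def)

lemma J_cov11: "J (cov11 g (RicM g) k i l) = mc.cov k mc.Rv i $ l"
  by (simp add: cov11_def[abs_def] dpart_eq J_ops smooth_all J_RicM mc.cov_def mc.nab_def JOm_def)

lemma J_cov02: "J (cov02 g (Ric g) m i k) = mc.ip (mc.cov m mc.Rv i) (mc.e k)"
  by (simp add: cov02_def[abs_def] dpart_eq J_ops smooth_all J_Ric mc.ip_cov mc.ip_Rv JOm_def)

lemma J_cov12: "J (cov12 g (cov11 g (RicM g)) b a i l) = mc.cov2 b (\<lambda>a. mc.cov a mc.Rv) a i $ l"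
  by (simp add: cov12_def[abs_def] dpart_eq J_ops smooth_all J_cov11 mc.cov2_def mc.nab_def JOm_def)

lemma J_Lap11: "J (Lap11 g (RicM g) i l) = mc.lap i $ l"
  by (simp add: Lap11_def[abs_def] J_ops smooth_all J_cov12 mc.lap_def)

lemma J_Pt: "J (Pt g i j k) = mc.ip (mc.cov i mc.Rv j) (mc.e k) - mc.ip (mc.cov j mc.Rv i) (mc.e k)"
  by (simp add: Pt_def[abs_def] J_ops smooth_all J_cov02)

lemma J_normsq: "smooth F \<Longrightarrow> J (normsq g F) = mc.ip (mc.grad (J F)) (mc.grad (J F))"
  unfolding mc.ip_expand_right[of _ "mc.grad _"] mc.ip_grad
  by (simp add: normsq_def[abs_def] dpart_eq J_ops smooth_all mc.grad_def
      sum_distrib_right sum_distrib_left mult.commute mult.left_commute)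

sublocale mf: modified_flow jet_deriv "\<lambda>i j. Jg i j" "\<lambda>i j. JG i j" JOm Jh "J f"
  by unfold_locales
    (simp add: vec_eq_iff mc.nab_e_component JOm_def J_RicM J_HessU smooth_f)

definition potential :: "(real^'n) \<times> real \<Rightarrow> real" where
  "potential = (\<lambda>y. - Scal g y / 2 + dtime f y - normsq g f y / 2)"

lemma smooth_potential: "smooth potential"
  unfolding potential_def dtime_eq by (intro smooth_all)

lemma J_potential: "J potential = mf.pot"
  by (simp add: potential_def dtime_eq J_ops J_half smooth_all mf.pot_def J_Scal J_normsq)

section \<open>Curvature of the space-time connection\<close>

lemma tChr_simps:
  "tChr g f 0 a b None = (\<lambda>z. 0)"
  "tChr g f 0 (Some i) (Some j) (Some k) = Chr g i j k"
  "tChr g f 0 (Some i) None (Some k) = (\<lambda>z. - RicM g i k z + HessU g f i k z)"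
  "tChr g f 0 None (Some i) (Some k) = (\<lambda>z. - RicM g i k z + HessU g f i k z)"
  "tChr g f 0 None None (Some k) = gradU g potential k"
  by (auto simp: fun_eq_iff tChr_def potential_def split: option.split)

lemma smooth_tChr: "smooth (tChr g f 0 a b c)"
  by (cases a; cases b; cases c)
    (auto simp: tChr_simps intro!: smooth_all smooth_potential)

lemma J_tChr:
  "J (tChr g f 0 (Some i) (Some j) (Some k)) = JOm (Some i) j k"
  "J (tChr g f 0 (Some i) None (Some k)) = mf.S i $ k"
  "J (tChr g f 0 None (Some i) (Some k)) = JOm None i k"
  "J (tChr g f 0 None None (Some k)) = mc.grad mf.pot $ k"
  by (simp_all add: tChr_simps J_ops smooth_all smooth_potential J_gradU J_potential J_RicM J_HessU
      JOm_def mf.S_def)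

lemma smooth_tRiem: "smooth (tRiem g f 0 a b c d)"
  unfolding tRiem_def[abs_def] by (intro smooth_ops smooth_tChr)

text \<open>The summand for the time index disappears because all symbols with upper index
  \<open>None\<close> vanish.\<close>

lemma J_tRiem:
  "J (tRiem g f 0 a b c d) = jet_deriv a (J (tChr g f 0 b c d)) - jet_deriv b (J (tChr g f 0 a c d))
    + (\<Sum>m\<in>UNIV. J (tChr g f 0 b c (Some m)) * J (tChr g f 0 a (Some m) d)
        - J (tChr g f 0 a c (Some m)) * J (tChr g f 0 b (Some m) d))"
proof -
  have "J (tRiem g f 0 a b c d) = jet_deriv a (J (tChr g f 0 b c d)) - jet_deriv b (J (tChr g f 0 a c d))
    + (\<Sum>m\<in>UNIV. J (tChr g f 0 b c m) * J (tChr g f 0 a m d) - J (tChr g f 0 a c m) * J (tChr g f 0 b m d))"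
    by (simp add: tRiem_def[abs_def] J_ops smooth_ops smooth_tChr)
  then show ?thesis
    by (simp add: sum_option tChr_simps(1) J_0)
qed

lemma tRiem_E1: "J (tRiem g f 0 (Some i) (Some j) (Some k) (Some l)) = J (Riem g i j k l)"
  by (simp add: J_tRiem J_tChr J_Riem mc.cur_component)

lemma tRiem_E2: "J (tRiem g f 0 a b c None) = 0"
  by (simp add: J_tRiem tChr_simps J_0)

lemma tRiem_E3: "J (tRiem g f 0 (Some i) (Some j) None (Some l))
  = - J (cov11 g (RicM g) i j l) + J (cov11 g (RicM g) j i l)
    + (\<Sum>p\<in>UNIV. J (Riem g i j p l) * J (gradU g f p))"
proof -
  have "J (tRiem g f 0 (Some i) (Some j) None (Some l))
    = (mc.nab (Some i) (mf.S j) - mc.nab (Some j) (mf.S i)) $ l"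
    by (simp add: J_tRiem J_tChr mc.nab_def sum_subtractf mult.commute)
  then show ?thesis
    unfolding mf.curvature_spatial_time
    by (simp add: J_cov11 J_Riem J_gradU smooth_f mult.commute)
qed

text \<open>The symbols with a spatial lower last index are the coefficients of \<open>nab\<close>,
  so this component is the mixed curvature itself.\<close>

lemma J_tRiem_mixed: "J (tRiem g f 0 (Some i) None (Some k) (Some l)) = mc.cur (Some i) None (mc.e k) $ l"
  by (simp add: J_tRiem J_tChr mc.cur_component mf.Om_S)

lemma tRiem_E3': "J (tRiem g f 0 (Some i) None (Some k) (Some l))
  = - (\<Sum>m\<in>UNIV. J (ginv g l m) * J (cov02 g (Ric g) m i k)) + J (cov11 g (RicM g) k i l)
    + (\<Sum>p\<in>UNIV. J (Riem g i p k l) * J (gradU g f p))"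
  unfolding J_tRiem_mixed mf.mixed_curvature
  by (simp add: J_cov11 J_cov02 J_Riem J_gradU smooth_f mc.Y_def mult.commute)

lemma J_tRiem_time_time: "J (tRiem g f 0 (Some i) None None (Some l))
  = (mc.nab (Some i) (mc.grad mf.pot) - mc.nab None (mf.S i)) $ l"
  by (simp add: J_tRiem J_tChr mc.nab_def sum_subtractf mult.commute)

lemma sum_mixed_curvature_gradient: "(\<Sum>k\<in>UNIV. mf.V $ k * mc.cur (Some i) None (mc.e k) $ l)
  = - (\<Sum>p\<in>UNIV. (\<Sum>m\<in>UNIV. J (ginv g l m) * J (cov02 g (Ric g) m i p)) * J (gradU g f p))
    + (\<Sum>p\<in>UNIV. J (cov11 g (RicM g) p i l) * J (gradU g f p))
    + (\<Sum>p\<in>UNIV. \<Sum>q\<in>UNIV. J (Riem g i p q l) * J (gradU g f p) * J (gradU g f q))"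
proof -
  have "(\<Sum>k\<in>UNIV. \<Sum>p\<in>UNIV. mf.V $ k * (mf.V $ p * mc.cur (Some i) (Some p) (mc.e k) $ l))
    = (\<Sum>p\<in>UNIV. \<Sum>q\<in>UNIV. J (Riem g i p q l) * J (gradU g f p) * J (gradU g f q))"
    by (subst sum.swap) (simp add: J_Riem J_gradU smooth_f mult.commute mult.left_commute)
  then show ?thesis
    unfolding mf.mixed_curvature
    by (simp add: J_cov11 J_cov02 J_gradU smooth_f mc.Y_def distrib_left sum.distrib sum_distrib_left
        sum_negf sum_subtractf right_diff_distrib mult.commute mult.left_commute)
qed

text \<open>Here \<open>nab None (Rv i)\<close> is written as the time derivative of the components
  plus the action of \<open>S\<close> on the upper index.\<close>

lemma tRiem_E4: "J (tRiem g f 0 (Some i) None None (Some l)) =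
    J (dtime (RicM g i l))
    - (\<Sum>p\<in>UNIV. J (gradU g f p) * J (cov11 g (RicM g) p i l))
    - Jh * J (HessU g (Scal g) i l)
    - (\<Sum>p\<in>UNIV. J (RicM g i p) * J (RicM g p l))
    - (\<Sum>p\<in>UNIV. (J (cov11 g (RicM g) i p l) - J (cov11 g (RicM g) p i l)) * J (gradU g f p))
    - (\<Sum>p\<in>UNIV. ((\<Sum>m\<in>UNIV. J (ginv g l m) * J (cov02 g (Ric g) m i p))
        - J (cov11 g (RicM g) p i l)) * J (gradU g f p))
    + (\<Sum>p\<in>UNIV. J (RicM g i p) * J (HessU g f p l))
    - (\<Sum>p\<in>UNIV. J (RicM g p l) * J (HessU g f i p))
    + (\<Sum>p\<in>UNIV. \<Sum>q\<in>UNIV. J (Riem g i p q l) * J (gradU g f p) * J (gradU g f q))"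
proof -
  have "mc.nab None (mc.Rv i) $ l = J (dtime (RicM g i l))
      + (- (\<Sum>p\<in>UNIV. J (RicM g i p) * J (RicM g p l)) + (\<Sum>p\<in>UNIV. J (RicM g i p) * J (HessU g f p l)))"
    by (simp add: mc.nab_def[of None] mf.Om_S mf.S_def dtime_eq J_tdpart smooth_all J_RicM J_HessU
        left_diff_distrib right_diff_distrib sum_subtractf mult.commute)
  then show ?thesis
    unfolding J_tRiem_time_time mf.time_time_curvature
    by (simp add: sum_mixed_curvature_gradient)
      (simp add: J_RicM J_HessU J_cov11 J_gradU J_Scal smooth_all sum_subtractf left_diff_distrib
        mult.commute algebra_simps)
qed

text \<open>Here \<open>nab None (Rv i)\<close> is replaced by \<open>Rv_evolution\<close>. The
  Hessian terms cancel, and the derivatives of the Ricci tensor along the gradient combine with the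
  others into the two \<open>Pt\<close> terms.\<close>

lemma tRiem_E4': "J (tRiem g f 0 (Some i) None None (Some l)) =
    J (Lap11 g (RicM g) i l)
    - Jh * J (HessU g (Scal g) i l)
    + 2 * (\<Sum>m\<in>UNIV. \<Sum>p\<in>UNIV. \<Sum>q\<in>UNIV. J (ginv g l m) * J (Riem g p i m q) * J (RicM g q p))
    - (\<Sum>m\<in>UNIV. J (RicM g i m) * J (RicM g m l))
    - (\<Sum>q\<in>UNIV. \<Sum>p\<in>UNIV. J (ginv g q l) * J (Pt g i p q) * J (gradU g f p))
    - (\<Sum>q\<in>UNIV. \<Sum>p\<in>UNIV. J (ginv g q l) * J (Pt g q p i) * J (gradU g f p))
    + (\<Sum>p\<in>UNIV. \<Sum>q\<in>UNIV. J (Riem g i p q l) * J (gradU g f p) * J (gradU g f q))"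
proof -
  have Z: "(\<Sum>m\<in>UNIV. J (ginv g l m) * (2 * mc.Z i m))
    = 2 * (\<Sum>m\<in>UNIV. \<Sum>p\<in>UNIV. \<Sum>q\<in>UNIV. J (ginv g l m) * J (Riem g p i m q) * J (RicM g q p))"
    by (simp add: mc.Z_def J_Riem J_RicM sum_distrib_left mult.commute mult.left_commute)
  have P1: "(\<Sum>q\<in>UNIV. \<Sum>p\<in>UNIV. J (ginv g q l) * J (Pt g i p q) * J (gradU g f p))
    = (\<Sum>p\<in>UNIV. J (cov11 g (RicM g) i p l) * J (gradU g f p))
      - (\<Sum>p\<in>UNIV. J (cov11 g (RicM g) p i l) * J (gradU g f p))"
  proof -
    have "(\<Sum>q\<in>UNIV. \<Sum>p\<in>UNIV. J (ginv g q l) * J (Pt g i p q) * J (gradU g f p))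
      = (\<Sum>p\<in>UNIV. (\<Sum>q\<in>UNIV. JG l q * mc.ip (mc.cov i mc.Rv p - mc.cov p mc.Rv i) (mc.e q)) * J (gradU g f p))"
      by (subst sum.swap) (simp add: J_Pt mc.ip_diff_left sum_distrib_right JG_sym[of _ l])
    also have "\<dots> = (\<Sum>p\<in>UNIV. (mc.cov i mc.Rv p - mc.cov p mc.Rv i) $ l * J (gradU g f p))"
      by (simp only: mc.component_ip[symmetric])
    finally show ?thesis
      by (simp add: J_cov11 left_diff_distrib sum_subtractf)
  qed
  have P2: "(\<Sum>q\<in>UNIV. \<Sum>p\<in>UNIV. J (ginv g q l) * J (Pt g q p i) * J (gradU g f p))
    = (\<Sum>p\<in>UNIV. (\<Sum>m\<in>UNIV. J (ginv g l m) * J (cov02 g (Ric g) m i p)) * J (gradU g f p))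
      - (\<Sum>p\<in>UNIV. J (cov11 g (RicM g) p i l) * J (gradU g f p))"
  proof -
    have "(\<Sum>q\<in>UNIV. \<Sum>p\<in>UNIV. J (ginv g q l) * J (Pt g q p i) * J (gradU g f p))
      = (\<Sum>p\<in>UNIV. (\<Sum>q\<in>UNIV. JG l q * mc.ip (mc.cov q mc.Rv i) (mc.e p)) * J (gradU g f p))
       - (\<Sum>p\<in>UNIV. (\<Sum>q\<in>UNIV. JG l q * mc.ip (mc.cov p mc.Rv i) (mc.e q)) * J (gradU g f p))"
      by (subst sum.swap) (simp add: J_Pt mc.ip_cov_Rv_sym[of _ _ i] sum_distrib_right JG_sym[of _ l]
          left_diff_distrib right_diff_distrib sum_subtractf)
    also have "(\<Sum>p\<in>UNIV. (\<Sum>q\<in>UNIV. JG l q * mc.ip (mc.cov p mc.Rv i) (mc.e q)) * J (gradU g f p))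
      = (\<Sum>p\<in>UNIV. mc.cov p mc.Rv i $ l * J (gradU g f p))"
      by (simp only: mc.component_ip[symmetric])
    finally show ?thesis
      by (simp add: J_cov11 J_cov02)
  qed
  have "mc.nab None (mc.Rv i) $ l = (\<Sum>p\<in>UNIV. J (cov11 g (RicM g) p i l) * J (gradU g f p))
     + (\<Sum>p\<in>UNIV. J (RicM g p l) * J (HessU g f i p)) + J (Lap11 g (RicM g) i l)
     + 2 * (\<Sum>m\<in>UNIV. \<Sum>p\<in>UNIV. \<Sum>q\<in>UNIV. J (ginv g l m) * J (Riem g p i m q) * J (RicM g q p))
     - (\<Sum>m\<in>UNIV. J (RicM g i m) * J (RicM g m l))"
    unfolding mf.Rv_evolution Z[symmetric]
    by (simp add: J_RicM J_HessU J_cov11 J_gradU J_Lap11 smooth_all mult.commute)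
  then show ?thesis
    unfolding J_tRiem_time_time mf.time_time_curvature P1 P2
    by (simp add: sum_mixed_curvature_gradient)
      (simp add: J_RicM J_HessU J_cov11 J_gradU J_Scal smooth_all mult.commute)
qed

lemma value_J: "smooth F \<Longrightarrow> value_jet (J F) = F z" "value_jet Jh = 1 / 2"
  by (simp_all add: value_jet_def J_value Jh_def Cinf_on_const)

end

text \<open>A kernel vector would make the quadratic form vanish.\<close>

lemma positive_definite_det:
  fixes A :: "'n::finite \<Rightarrow> 'n \<Rightarrow> real"
  assumes "\<And>v :: real^'n. v \<noteq> 0 \<Longrightarrow> (\<Sum>i\<in>UNIV. \<Sum>j\<in>UNIV. v $ i * A i j * v $ j) > 0"
  shows "det (\<chi> a b. A a b) \<noteq> 0"
proof -
  have "v = 0" if "(\<chi> a b. A a b) *v v = 0" for v :: "real^'n"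
  proof -
    have "(\<Sum>j\<in>UNIV. A i j * v $ j) = 0" for i
      using arg_cong[OF that, of "\<lambda>w. w $ i"] by (simp add: matrix_vector_mult_def)
    then have "(\<Sum>i\<in>UNIV. \<Sum>j\<in>UNIV. v $ i * A i j * v $ j) = 0"
      by (simp add: mult.assoc flip: sum_distrib_left)
    then show ?thesis using assms[of v] by fastforce
  qed
  then have "invertible (\<chi> a b. A a b)"
    unfolding invertible_left_inverse matrix_left_invertible_ker by blast
  then show ?thesis by (simp add: invertible_det_nz)
qed

theorem theorem3p1:   fixes g :: "('n::finite) metric" and f :: "(real^'n) \<times> real \<Rightarrow> real"
    and U :: "(real^'n) set" and W :: "((real^'n) \<times> real) set"
    and T \<tau> t :: real and x :: "real^'n"
  assumes U_open: "open U"
    and W_open: "open W" and UW: "U \<times> {0..<T} \<subseteq> W"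
    and g_smooth: "\<And>i j. Cinf_on W (g i j)"
    and f_smooth: "Cinf_on W f"
    and g_sym: "\<And>i j y s. y \<in> U \<Longrightarrow> 0 \<le> s \<Longrightarrow> s < T \<Longrightarrow> g i j (y, s) = g j i (y, s)"
    and g_pos: "\<And>v y s. y \<in> U \<Longrightarrow> 0 \<le> s \<Longrightarrow> s < T \<Longrightarrow> v \<noteq> 0 \<Longrightarrow>
                 (\<Sum>i\<in>UNIV. \<Sum>j\<in>UNIV. v $ i * g i j (y, s) * v $ j) > 0"
    and flow: "\<And>i j y s. y \<in> U \<Longrightarrow> 0 \<le> s \<Longrightarrow> s < T \<Longrightarrow>
                 dtime (g i j) (y, s) = - 2 * Ric g i j (y, s) + 2 * Hess g f i j (y, s)"
    and tau: "0 \<le> \<tau>" "\<tau> < T"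
    and x: "x \<in> U" and t: "0 \<le> t" "t < T - \<tau>"
  shows
   "(\<forall>i j k l. tRiem g f \<tau> (Some i) (Some j) (Some k) (Some l) (x, t) = Riem g i j k l (x, t + \<tau>))
  \<and> (\<forall>i j k. tRiem g f \<tau> (Some i) (Some j) (Some k) None (x, t) = 0)
  \<and> (\<forall>i j l. tRiem g f \<tau> (Some i) (Some j) None (Some l) (x, t) =
        - cov11 g (RicM g) i j l (x, t + \<tau>) + cov11 g (RicM g) j i l (x, t + \<tau>)
        + (\<Sum>p\<in>UNIV. Riem g i j p l (x, t + \<tau>) * gradU g f p (x, t + \<tau>)))
  \<and> (\<forall>i k l. tRiem g f \<tau> (Some i) None (Some k) (Some l) (x, t) =
        - (\<Sum>m\<in>UNIV. ginv g l m (x, t + \<tau>) * cov02 g (Ric g) m i k (x, t + \<tau>))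
        + cov11 g (RicM g) k i l (x, t + \<tau>)
        + (\<Sum>p\<in>UNIV. Riem g i p k l (x, t + \<tau>) * gradU g f p (x, t + \<tau>)))
  \<and> (\<forall>i l. tRiem g f \<tau> (Some i) None None (Some l) (x, t) =
        dtime (RicM g i l) (x, t + \<tau>)
        - (\<Sum>p\<in>UNIV. gradU g f p (x, t + \<tau>) * cov11 g (RicM g) p i l (x, t + \<tau>))
        - (1/2) * HessU g (Scal g) i l (x, t + \<tau>)
        - (\<Sum>p\<in>UNIV. RicM g i p (x, t + \<tau>) * RicM g p l (x, t + \<tau>))
        - (\<Sum>p\<in>UNIV. (cov11 g (RicM g) i p l (x, t + \<tau>) - cov11 g (RicM g) p i l (x, t + \<tau>))
                        * gradU g f p (x, t + \<tau>))
        - (\<Sum>p\<in>UNIV. ((\<Sum>m\<in>UNIV. ginv g l m (x, t + \<tau>) * cov02 g (Ric g) m i p (x, t + \<tau>))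
                         - cov11 g (RicM g) p i l (x, t + \<tau>)) * gradU g f p (x, t + \<tau>))
        + (\<Sum>p\<in>UNIV. RicM g i p (x, t + \<tau>) * HessU g f p l (x, t + \<tau>))
        - (\<Sum>p\<in>UNIV. RicM g p l (x, t + \<tau>) * HessU g f i p (x, t + \<tau>))
        + (\<Sum>p\<in>UNIV. \<Sum>q\<in>UNIV. Riem g i p q l (x, t + \<tau>)
                         * gradU g f p (x, t + \<tau>) * gradU g f q (x, t + \<tau>))
      \<and> tRiem g f \<tau> (Some i) None None (Some l) (x, t) =
        Lap11 g (RicM g) i l (x, t + \<tau>)
        - (1/2) * HessU g (Scal g) i l (x, t + \<tau>)
        + 2 * (\<Sum>m\<in>UNIV. \<Sum>p\<in>UNIV. \<Sum>q\<in>UNIV. ginv g l m (x, t + \<tau>)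
                         * Riem g p i m q (x, t + \<tau>) * RicM g q p (x, t + \<tau>))
        - (\<Sum>m\<in>UNIV. RicM g i m (x, t + \<tau>) * RicM g m l (x, t + \<tau>))
        - (\<Sum>q\<in>UNIV. \<Sum>p\<in>UNIV. ginv g q l (x, t + \<tau>) * Pt g i p q (x, t + \<tau>) * gradU g f p (x, t + \<tau>))
        - (\<Sum>q\<in>UNIV. \<Sum>p\<in>UNIV. ginv g q l (x, t + \<tau>) * Pt g q p i (x, t + \<tau>) * gradU g f p (x, t + \<tau>))
        + (\<Sum>p\<in>UNIV. \<Sum>q\<in>UNIV. Riem g i p q l (x, t + \<tau>)
                         * gradU g f p (x, t + \<tau>) * gradU g f q (x, t + \<tau>)))"
proof -
  \<comment> \<open>Positivity is known on \<open>U \<times> {0..<T}\<close> only, so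
    \<open>W\<close> is shrunk to the open set where the metric is invertible, which still contains
    that region.\<close>
  define W' where "W' = {y \<in> W. det (\<chi> a b. g a b y) \<noteq> 0}"
  have "continuous_on W (\<lambda>y. det (\<chi> a b. g a b y))"
    using Cinf_on_det[where A = g, OF W_open g_smooth] Ck_continuous[OF _ W_open]
    unfolding Cinf_on_def by blast
  from continuous_open_preimage[OF this W_open, of "- {0}"]
  have W'_open: "open W'"
    by (simp add: W'_def vimage_def Int_def open_Compl)
  have det: "det (\<chi> a b. g a b (y, s)) \<noteq> 0" if "y \<in> U" "0 \<le> s" "s < T" for y s
    using g_pos[OF that] by (rule positive_definite_det)
  interpret metric_region W' U T "(x, t + \<tau>)" g f
  proof
    show "open W'" by (rule W'_open)
    show "U \<times> {0..<T} \<subseteq> W'" using UW det by (auto simp: W'_def)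
    show "(x, t + \<tau>) \<in> U \<times> {0..<T}" using x t tau by auto
    show "Cinf_on W' (g i j)" for i j
      by (rule Cinf_on_subset[OF g_smooth]) (simp add: W'_def)
    show "Cinf_on W' f"
      by (rule Cinf_on_subset[OF f_smooth]) (simp add: W'_def)
  qed (auto simp: U_open W'_def g_sym flow)
  note jet_values = value_jet_hom value_jet_sum value_J smooth_all smooth_tRiem dtime_eq
  show ?thesis
    unfolding tRiem_shift[of g f \<tau>]
    \<comment> \<open>\<open>value_jet\<close> is a ring homomorphism, so it turns each jet identity
      into an identity of values at the shifted point.\<close>
    using arg_cong[OF tRiem_E1, of value_jet] arg_cong[OF tRiem_E2, of value_jet]
      arg_cong[OF tRiem_E3, of value_jet] arg_cong[OF tRiem_E3', of value_jet]
      arg_cong[OF tRiem_E4, of value_jet] arg_cong[OF tRiem_E4', of value_jet]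
    by (intro conjI allI) (simp_all only: jet_values simp_thms)
qed

end
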